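(* Let $q$ be any number from the set $\{2,3,4\}$. Then there are infinitely many homogeneous spaces $SO(k+l+m)/SO(k)\times SO(l)\times SO(m)$ ($k,l,m$ positive integers) that admit exactly $q$ invariant Einstein metrics up to a homothety.
   Context: Let $n=k+l+m$, $\mathfrak g=so(n)$, $\mathfrak h=so(k)\oplus so(l)\oplus so(m)$ (block-diagonal), let $B$ be the Killing form of $\mathfrak g$, $\langle\cdot,\cdot\rangle=-B$, and let $\mathfrak p$ be the $\langle\cdot,\cdot\rangle$-orthogonal complement of $\mathfrak h$ in $\mathfrak g$. Then $\mathfrak p=\mathfrak p_1\oplus\mathfrak p_2\oplus\mathfrak p_3$ orthogonally, where $\mathfrak p_1,\mathfrak p_2,\mathfrak p_3$ are the off-diagonal block subspaces of dimensions $lm$, $km$, $kl$ (coupling the blocks $l,m$; $k,m$; $k,l$ respectively), and $[\mathfrak p_i,\mathfrak p_i]\subset\mathfrak h$. The invariant metrics considered are the three-parameter family determined by the $\mathrm{Ad}(H)$-invariant inner products $x_1\langle\cdot,\cdot\rangle|_{\mathfrak p_1}+x_2\langle\cdot,\cdot\rangle|_{\mathfrak p_2}+x_3\langle\cdot,\cdot\rangle|_{\mathfrak p_3}$ with $x_1,x_2,x_3>0$. Put $a_1=\frac{k}{2(n-2)}$, $a_2=\frac{l}{2(n-2)}$, $a_3=\frac{m}{2(n-2)}$. The Ricci tensor of such a metric $(\cdot,\cdot)$ equals $\sum_i r_i\,(\cdot,\cdot)|_{\mathfrak p_i}$ with $$r_i=\frac{1}{2x_i}+\frac{a_i}{2}\left(\frac{x_i}{x_jx_k}-\frac{x_k}{x_ix_j}-\frac{x_j}{x_ix_k}\right),\qquad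 \{i,j,k\}=\{1,2,3\}$$ (in this formula $k$ is an index), so the metric is Einstein if and only if $r_1=r_2=r_3$. "Up to a homothety" means that $(x_1,x_2,x_3)$ and $(cx_1,cx_2,cx_3)$, $c>0$, are identified (and no further identification is made). *)

theory Defs
  imports "Jordan_Normal_Form.Matrix"
begin

definition so :: "nat \<Rightarrow> real mat set" where
  "so n = {A \<in> carrier_mat n n. transpose_mat A = - A}"

definition lie_bracket :: "real mat \<Rightarrow> real mat \<Rightarrow> real mat" where
  "lie_bracket A B = A * B - B * A"

definition so_unit :: "nat \<Rightarrow> nat \<Rightarrow> nat \<Rightarrow> real mat" where
  "so_unit n i j = mat n n (\<lambda>(a, b). if (a, b) = (i, j) then 1 else if (a, b) = (j, i) then -1 else 0)"

text \<open>For a set \<open>I\<close> of index pairs \<open>i < j < n\<close>, the matrices \<open>so_unit n i j\<close>, \<open>(i, j) \<in> I\<close>, form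
  a basis of a subspace of \<open>so n\<close>, and the coordinate of \<open>A\<close> with respect to \<open>so_unit n i j\<close> is the
  entry \<open>A $$ (i, j)\<close>. So \<open>trace_on n I T\<close> is the trace of a linear endomorphism \<open>T\<close> of this
  subspace.\<close>

definition trace_on :: "nat \<Rightarrow> (nat \<times> nat) set \<Rightarrow> (real mat \<Rightarrow> real mat) \<Rightarrow> real" where
  "trace_on n I T = (\<Sum>(i, j)\<in>I. T (so_unit n i j) $$ (i, j))"

definition killing :: "nat \<Rightarrow> real mat \<Rightarrow> real mat \<Rightarrow> real" where
  "killing n A B = trace_on n {(i, j). i < j \<and> j < n} (\<lambda>Z. lie_bracket A (lie_bracket B Z))"

text \<open>Orthogonal projection onto a subspace \<open>U\<close> of \<open>so n\<close>; for \<open>n \<ge> 3\<close> the Killing form is negative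
  definite, so the description is unique and independent of the sign of the form.\<close>

definition proj_onto :: "nat \<Rightarrow> real mat set \<Rightarrow> real mat \<Rightarrow> real mat" where
  "proj_onto n U X = (THE A. A \<in> U \<and> (\<forall>Z\<in>U. killing n (X - A) Z = 0))"

definition block :: "nat \<Rightarrow> nat \<Rightarrow> nat \<Rightarrow> nat" where
  "block k l i = (if i < k then 1 else if i < k + l then 2 else 3)"

definition isotropy :: "nat \<Rightarrow> nat \<Rightarrow> nat \<Rightarrow> real mat set" where
  "isotropy k l m = {A \<in> so (k + l + m). \<forall>a < k + l + m. \<forall>b < k + l + m.
     block k l a \<noteq> block k l b \<longrightarrow> A $$ (a, b) = 0}"

definition tangent :: "nat \<Rightarrow> nat \<Rightarrow> nat \<Rightarrow> real mat set" where
  "tangent k l m = {A \<in> so (k + l + m). \<forall>Z \<in> isotropy k l m. killing (k + l + m) A Z = 0}"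

text \<open>For \<open>i \<in> {1, 2, 3}\<close>, the summand of the tangent space that couples the two blocks other than
  block \<open>i\<close>.\<close>

definition tangent_summand :: "nat \<Rightarrow> nat \<Rightarrow> nat \<Rightarrow> nat \<Rightarrow> real mat set" where
  "tangent_summand k l m i = {A \<in> so (k + l + m). \<forall>a < k + l + m. \<forall>b < k + l + m.
     {block k l a, block k l b} \<noteq> {1, 2, 3} - {i} \<longrightarrow> A $$ (a, b) = 0}"

definition metric ::
  "nat \<Rightarrow> nat \<Rightarrow> nat \<Rightarrow> real \<times> real \<times> real \<Rightarrow> real mat \<Rightarrow> real mat \<Rightarrow> real" where
  "metric k l m = (\<lambda>(x1, x2, x3) X Y.
     (let n = k + l + m;
          ip = (\<lambda>i. - killing n (proj_onto n (tangent_summand k l m i) X)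
                             (proj_onto n (tangent_summand k l m i) Y))
      in x1 * ip 1 + x2 * ip 2 + x3 * ip 3))"

definition bracket_p :: "nat \<Rightarrow> nat \<Rightarrow> nat \<Rightarrow> real mat \<Rightarrow> real mat \<Rightarrow> real mat" where
  "bracket_p k l m X Y = proj_onto (k + l + m) (tangent k l m) (lie_bracket X Y)"

definition bracket_h :: "nat \<Rightarrow> nat \<Rightarrow> nat \<Rightarrow> real mat \<Rightarrow> real mat \<Rightarrow> real mat" where
  "bracket_h k l m X Y = proj_onto (k + l + m) (isotropy k l m) (lie_bracket X Y)"

text \<open>The tangent space \<open>\<pp>\<close> at the base point of the reductive homogeneous space carries the
  Levi-Civita connection of the invariant metric \<open>(\<cdot>,\<cdot>)\<close> as the bilinear map (see Kobayashi and
  Nomizu, Foundations of Differential Geometry II, Chapter X, Theorems 2.3 and 3.3)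
  \<open>\<Lambda>(X) Y = [X, Y]\<^sub>\<pp> / 2 + U(X, Y)\<close>, where
  \<open>2 (U(X, Y), Z) = ([Z, X]\<^sub>\<pp>, Y) + (X, [Z, Y]\<^sub>\<pp>)\<close> for all \<open>Z\<close> in \<open>\<pp>\<close>. The curvature tensor is
  \<open>R(X, Y) Z = \<Lambda>(X) \<Lambda>(Y) Z - \<Lambda>(Y) \<Lambda>(X) Z - \<Lambda>([X, Y]\<^sub>\<pp>) Z - [[X, Y]\<^sub>\<hh>, Z]\<close>, and the Ricci tensor is
  \<open>Ric(Y, Z) = tr (X \<mapsto> R(X, Y) Z)\<close>.\<close>

definition lc_sym ::
  "nat \<Rightarrow> nat \<Rightarrow> nat \<Rightarrow> real \<times> real \<times> real \<Rightarrow> real mat \<Rightarrow> real mat \<Rightarrow> real mat" where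
  "lc_sym k l m x X Y = (THE V. V \<in> tangent k l m \<and>
     (\<forall>Z \<in> tangent k l m. 2 * metric k l m x V Z =
        metric k l m x (bracket_p k l m Z X) Y + metric k l m x X (bracket_p k l m Z Y)))"

definition levi_civita ::
  "nat \<Rightarrow> nat \<Rightarrow> nat \<Rightarrow> real \<times> real \<times> real \<Rightarrow> real mat \<Rightarrow> real mat \<Rightarrow> real mat" where
  "levi_civita k l m x X Y = (1/2) \<cdot>\<^sub>m bracket_p k l m X Y + lc_sym k l m x X Y"

definition curvature ::
  "nat \<Rightarrow> nat \<Rightarrow> nat \<Rightarrow> real \<times> real \<times> real \<Rightarrow> real mat \<Rightarrow> real mat \<Rightarrow> real mat \<Rightarrow> real mat" where
  "curvature k l m x X Y Z =
     levi_civita k l m x X (levi_civita k l m x Y Z)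
     - levi_civita k l m x Y (levi_civita k l m x X Z)
     - levi_civita k l m x (bracket_p k l m X Y) Z
     - lie_bracket (bracket_h k l m X Y) Z"

text \<open>The index set selects the \<open>so_unit\<close> basis of the tangent space, which is the space of
  skew-symmetric matrices with vanishing diagonal blocks.\<close>

definition ricci ::
  "nat \<Rightarrow> nat \<Rightarrow> nat \<Rightarrow> real \<times> real \<times> real \<Rightarrow> real mat \<Rightarrow> real mat \<Rightarrow> real" where
  "ricci k l m x Y Z =
     trace_on (k + l + m) {(i, j). i < j \<and> j < k + l + m \<and> block k l i \<noteq> block k l j}
       (\<lambda>X. curvature k l m x X Y Z)"

definition einstein_metrics :: "nat \<Rightarrow> nat \<Rightarrow> nat \<Rightarrow> (real \<times> real \<times> real) set" where
  "einstein_metrics k l m = {x. (case x of (x1, x2, x3) \<Rightarrow> 0 < x1 \<and> 0 < x2 \<and> 0 < x3) \<and>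
     (\<exists>c. \<forall>X \<in> tangent k l m. \<forall>Y \<in> tangent k l m.
        ricci k l m x X Y = c * metric k l m x X Y)}"

definition homothety :: "((real \<times> real \<times> real) \<times> (real \<times> real \<times> real)) set" where
  "homothety = {((x1, x2, x3), (y1, y2, y3)). \<exists>c > 0. y1 = c * x1 \<and> y2 = c * x2 \<and> y3 = c * x3}"

end

theory Submission imports Defs
begin

text \<open>The Killing form of \<open>so n\<close> is \<open>2 - n\<close> times the entrywise inner product, so the orthogonal
  projections onto the spaces involved only delete matrix entries, and the Levi-Civita map has an
  explicit entry formula. The Ricci tensor then comes out as a sum over entries, with a
  coefficient that depends only on the pair of blocks, and the Einstein condition becomes the
  equality of three quadratic forms in \<open>x1, x2, x3\<close>.

  If \<open>l = m\<close>, subtracting the last two forms leaves either \<open>x2 = x3\<close> and a quadratic equation for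
  \<open>x1 / x2\<close>, or \<open>(n - 2) x1 = l (x2 + x3)\<close> and a quadratic equation for \<open>x2 / x3\<close>. For
  \<open>(k, 2, 2)\<close> with \<open>k \<ge> 3\<close> the first has two solutions and the second none; for
  \<open>(2 s, 1 + s\<^sup>2, 1 + s\<^sup>2)\<close> with \<open>s \<ge> 2\<close> the first has a double root and the second two solutions;
  for \<open>(t, t, t)\<close> with \<open>t \<ge> 3\<close> there are four solutions.\<close>

subsection \<open>The Killing form and projections\<close>

text \<open>This is the trace form tr(A^T B). On skew matrices every unordered pair of indices
  counts twice.\<close>

definition ip :: "nat \<Rightarrow> real mat \<Rightarrow> real mat \<Rightarrow> real" where
  "ip n A B = (\<Sum>a<n. \<Sum>b<n. A $$ (a, b) * B $$ (a, b))"

lemma so_carrier: "A \<in> so n \<Longrightarrow> A \<in> carrier_mat n n"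
  by (simp add: so_def)

lemma so_dim [simp]: "A \<in> so n \<Longrightarrow> dim_row A = n" "A \<in> so n \<Longrightarrow> dim_col A = n"
  by (auto simp: so_def)

lemma so_skew:
  assumes "A \<in> so n" "i < n" "j < n"
  shows "A $$ (j, i) = - A $$ (i, j)"
proof -
  have "transpose_mat A $$ (i, j) = (- A) $$ (i, j)"
    using assms by (simp add: so_def)
  then show ?thesis
    using assms by auto
qed

lemma so_diag: "A \<in> so n \<Longrightarrow> i < n \<Longrightarrow> A $$ (i, i) = 0"
  using so_skew[of A n i i] by simp

lemma soI:
  assumes "A \<in> carrier_mat n n"
    and "\<And>i j. i < n \<Longrightarrow> j < n \<Longrightarrow> A $$ (j, i) = - A $$ (i, j)"
  shows "A \<in> so n"
proof -
  have "transpose_mat A = - A"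
  proof (rule eq_matI)
    fix i j assume "i < dim_row (- A)" "j < dim_col (- A)"
    then show "transpose_mat A $$ (i, j) = (- A) $$ (i, j)"
      using assms(1) assms(2)[of i j] by simp
  qed (use assms(1) in auto)
  then show ?thesis
    using assms(1) by (simp add: so_def)
qed

lemma index_mult_mat_sum:
  assumes "A \<in> carrier_mat n n" "B \<in> carrier_mat n n" "i < n" "j < n"
  shows "(A * B) $$ (i, j) = (\<Sum>c<n. A $$ (i, c) * B $$ (c, j))"
  using assms by (simp add: scalar_prod_def lessThan_atLeast0)

lemma lie_bracket_carrier:
  "A \<in> carrier_mat n n \<Longrightarrow> B \<in> carrier_mat n n \<Longrightarrow> lie_bracket A B \<in> carrier_mat n n"
  unfolding lie_bracket_def by (metis minus_carrier_mat mult_carrier_mat)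

lemma lie_bracket_index:
  assumes "A \<in> carrier_mat n n" "B \<in> carrier_mat n n" "i < n" "j < n"
  shows "lie_bracket A B $$ (i, j) =
    (\<Sum>c<n. A $$ (i, c) * B $$ (c, j)) - (\<Sum>c<n. B $$ (i, c) * A $$ (c, j))"
  using assms index_mult_mat_sum[OF assms] index_mult_mat_sum[OF assms(2,1,3,4)]
  by (simp add: lie_bracket_def del: index_mult_mat(1))

lemma lie_bracket_so:
  assumes "A \<in> so n" "B \<in> so n"
  shows "lie_bracket A B \<in> so n"
proof (rule soI)
  show "lie_bracket A B \<in> carrier_mat n n"
    using assms by (intro lie_bracket_carrier so_carrier)
next
  fix i j assume ij: "i < n" "j < n"
  have *: "(\<Sum>c<n. P $$ (j, c) * Q $$ (c, i)) = (\<Sum>c<n. Q $$ (i, c) * P $$ (c, j))"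
    if "P \<in> so n" "Q \<in> so n" for P Q
  proof (rule sum.cong)
    fix c assume "c \<in> {..<n}"
    then show "P $$ (j, c) * Q $$ (c, i) = Q $$ (i, c) * P $$ (c, j)"
      using so_skew[OF that(1), of c j] so_skew[OF that(2), of i c] ij by simp
  qed simp
  show "lie_bracket A B $$ (j, i) = - lie_bracket A B $$ (i, j)"
    using ij *[OF assms] *[OF assms(2,1)]
    by (simp add: lie_bracket_index[OF assms[THEN so_carrier]])
qed

section \<open>Elementary skew matrices and sums against their entries\<close>

lemma so_unit_carrier: "so_unit n i j \<in> carrier_mat n n"
  by (simp add: so_unit_def)

lemma so_unit_index:
  "i \<noteq> j \<Longrightarrow> a < n \<Longrightarrow> b < n \<Longrightarrow>
    so_unit n i j $$ (a, b) = of_bool (a = i \<and> b = j) - of_bool (a = j \<and> b = i)"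
  by (auto simp: so_unit_def)

lemma so_unit_so: "i \<noteq> j \<Longrightarrow> so_unit n i j \<in> so n"
  by (rule soI[OF so_unit_carrier]) (auto simp: so_unit_index)

lemma sum_times_so_unit:
  assumes "i < n" "j < n" "i \<noteq> j" "b < n"
  shows "(\<Sum>c<n. f c * so_unit n i j $$ (c, b)) = of_bool (b = j) * f i - of_bool (b = i) * f j"
proof -
  have "(\<Sum>c<n. f c * so_unit n i j $$ (c, b)) =
      (\<Sum>c<n. (if c = i then of_bool (b = j) * f i else 0) - (if c = j then of_bool (b = i) * f j else 0))"
    using assms by (intro sum.cong) (auto simp: so_unit_index)
  also have "\<dots> = of_bool (b = j) * f i - of_bool (b = i) * f j"
    using assms by (simp add: sum_subtractf)
  finally show ?thesis .
qed

lemma sum_so_unit_times: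
  assumes "i < n" "j < n" "i \<noteq> j" "a < n"
  shows "(\<Sum>c<n. so_unit n i j $$ (a, c) * f c) = of_bool (a = i) * f j - of_bool (a = j) * f i"
proof -
  have "(\<Sum>c<n. so_unit n i j $$ (a, c) * f c) =
      (\<Sum>c<n. (if c = j then of_bool (a = i) * f j else 0) - (if c = i then of_bool (a = j) * f i else 0))"
    using assms by (intro sum.cong) (auto simp: so_unit_index)
  also have "\<dots> = of_bool (a = i) * f j - of_bool (a = j) * f i"
    using assms by (simp add: sum_subtractf)
  finally show ?thesis .
qed

lemma sum_single_of_bool:
  fixes f :: "nat \<Rightarrow> real"
  assumes "i < n"
  shows "(\<Sum>c<n. of_bool (c = i) * f c) = f i"
proof -
  have "(\<Sum>c<n. of_bool (c = i) * f c) = (\<Sum>c<n. if c = i then f c else 0)"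
    by (intro sum.cong) auto
  then show ?thesis
    using assms by simp
qed

text \<open>Traces are taken over basis vectors with i < j. A summand that splits into two parts
  exchanged by i and j turns the trace into a full double sum, because the lower triangle is the
  mirror image of the upper one. \<open>f\<close> itself may be asymmetric.\<close>

lemma sum_unordered_pairs:
  fixes f :: "nat \<Rightarrow> nat \<Rightarrow> real"
  assumes "\<And>i. \<not> P i i" "\<And>i j. P i j \<Longrightarrow> P j i"
  shows "(\<Sum>(i, j) | i < j \<and> j < n \<and> P i j. f i j + f j i) =
    (\<Sum>i<n. \<Sum>j<n. of_bool (P i j) * f i j)"
proof -
  let ?L = "{(i, j). i < j \<and> j < n \<and> P i j}" and ?G = "{(i, j). j < i \<and> i < n \<and> P i j}"
  have fin: "finite ?L" "finite ?G"
    by (rule finite_subset[of _ "{..<n} \<times> {..<n}"]; auto)+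
  have "bij_betw prod.swap ?G ?L"
    by (rule bij_betw_byWitness[of _ prod.swap]) (auto intro: assms)
  then have swap: "(\<Sum>(i, j)\<in>?L. f j i) = (\<Sum>(i, j)\<in>?G. f i j)"
    by (subst sum.reindex_bij_betw[symmetric]) (auto intro!: sum.cong simp: prod.swap_def)
  have "(\<Sum>i<n. \<Sum>j<n. of_bool (P i j) * f i j) =
      (\<Sum>(i, j)\<in>{..<n} \<times> {..<n}. of_bool (P i j) * f i j)"
    by (simp only: sum.cartesian_product)
  also have "\<dots> = (\<Sum>(i, j)\<in>?L \<union> ?G. f i j)"
    using assms(1) by (intro sum.mono_neutral_cong_right) (auto, metis nat_neq_iff)
  also have "\<dots> = (\<Sum>(i, j)\<in>?L. f i j) + (\<Sum>(i, j)\<in>?G. f i j)"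
    using fin by (intro sum.union_disjoint) auto
  also have "\<dots> = (\<Sum>(i, j)\<in>?L. f i j + f j i)"
    by (simp only: swap[symmetric]) (simp only: sum.distrib[symmetric] split_def)
  finally show ?thesis
    by simp
qed

text \<open>The (i, j) coordinate of [A, [B, E_ij]] splits into \<open>f i j + f j i\<close>. In the
  double sum over i \<noteq> j each row sum of A_ic B_ic occurs once with sign plus and n - 1 times
  with sign minus, which leaves the factor -(n - 2).\<close>

lemma killing_so:
  assumes A: "A \<in> so n" and B: "B \<in> so n"
  shows "killing n A B = - (real n - 2) * ip n A B"
proof -
  let ?w = "\<lambda>a b. A $$ (a, b) * B $$ (a, b)"
  define f where "f i j = ?w i j - (\<Sum>c<n. ?w i c)" for i j
  have *: "lie_bracket A (lie_bracket B (so_unit n i j)) $$ (i, j) = f i j + f j i"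
    if ij: "i < j" "j < n" for i j
  proof -
    note cA = so_carrier[OF A] and cB = so_carrier[OF B] and cE = so_unit_carrier[of n i j]
    note cBE = lie_bracket_carrier[OF cB cE]
    have inn: "i < n" "j < n" "i \<noteq> j"
      using ij by auto
    \<comment> \<open>The bracketed factor is the entry (c, j) of [B, E_ij]; in \<open>s2\<close>
      the first factor is its entry (i, c).\<close>
    have s1: "(\<Sum>c<n. A $$ (i, c) * (B $$ (c, i) + of_bool (c = j) * B $$ (i, j))) =
        (\<Sum>c<n. - ?w i c + of_bool (c = j) * ?w i j)"
    proof (rule sum.cong)
      fix c assume "c \<in> {..<n}"
      then have "B $$ (c, i) = - B $$ (i, c)"
        using inn so_skew[OF B, of i c] by simp
      then show "A $$ (i, c) * (B $$ (c, i) + of_bool (c = j) * B $$ (i, j)) =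
          - ?w i c + of_bool (c = j) * ?w i j"
        by (cases "c = j") (simp_all add: algebra_simps)
    qed simp
    have s2: "(\<Sum>c<n. (- of_bool (c = i) * B $$ (i, j) - B $$ (j, c)) * A $$ (c, j)) =
        (\<Sum>c<n. - of_bool (c = i) * ?w i j + ?w j c)"
    proof (rule sum.cong)
      fix c assume "c \<in> {..<n}"
      then have "A $$ (c, j) = - A $$ (j, c)" "A $$ (j, i) = - A $$ (i, j)"
        using inn so_skew[OF A, of j c] so_skew[OF A, of i j] by simp_all
      then show "(- of_bool (c = i) * B $$ (i, j) - B $$ (j, c)) * A $$ (c, j) =
          - of_bool (c = i) * ?w i j + ?w j c"
        by (cases "c = i") (simp_all add: algebra_simps)
    qed simp
    have "lie_bracket A (lie_bracket B (so_unit n i j)) $$ (i, j) =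
      (\<Sum>c<n. A $$ (i, c) * (B $$ (c, i) + of_bool (c = j) * B $$ (i, j)))
      - (\<Sum>c<n. (- of_bool (c = i) * B $$ (i, j) - B $$ (j, c)) * A $$ (c, j))"
      using inn so_diag[OF B]
      by (simp add: lie_bracket_index[OF cA cBE] lie_bracket_index[OF cB cE]
          sum_times_so_unit sum_so_unit_times)
    also have "\<dots> = f i j + f j i"
      unfolding s1 s2
      using inn so_skew[OF A inn(1,2)] so_skew[OF B inn(1,2)]
      by (simp add: sum.distrib sum_subtractf sum_negf f_def sum_single_of_bool)
    finally show ?thesis .
  qed
  have "killing n A B = (\<Sum>(i, j) | i < j \<and> j < n \<and> i \<noteq> j. f i j + f j i)"
    unfolding killing_def trace_on_def by (intro sum.cong) (auto simp: *)
  also have "\<dots> = (\<Sum>i<n. \<Sum>j<n. of_bool (i \<noteq> j) * f i j)"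
    by (rule sum_unordered_pairs) auto
  \<comment> \<open>To drop the condition i \<noteq> j, the row sum subtracted at j = i is added
    back; the entry \<open>?w i i\<close> is zero anyway.\<close>
  also have "\<dots> = (\<Sum>i<n. \<Sum>j<n. ?w i j - (\<Sum>c<n. ?w i c) + of_bool (j = i) * (\<Sum>c<n. ?w i c))"
    using so_diag[OF A] by (intro sum.cong) (auto simp: f_def)
  also have "\<dots> = (\<Sum>i<n. - (real n - 2) * (\<Sum>c<n. ?w i c))"
    by (intro sum.cong) (auto simp: sum.distrib sum_subtractf sum_single_of_bool algebra_simps)
  also have "\<dots> = - (real n - 2) * ip n A B"
    by (simp only: ip_def sum_distrib_left[symmetric])
  finally show ?thesis .
qed

text \<open>The isotropy algebra, the tangent space and its three summands all have this form for a
  symmetric relation \<open>P\<close>, so a single projection lemma serves them all.\<close>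

definition coord_space :: "nat \<Rightarrow> (nat \<Rightarrow> nat \<Rightarrow> bool) \<Rightarrow> real mat set" where
  "coord_space n P = {A \<in> so n. \<forall>a<n. \<forall>b<n. \<not> P a b \<longrightarrow> A $$ (a, b) = 0}"

definition coord_proj :: "nat \<Rightarrow> (nat \<Rightarrow> nat \<Rightarrow> bool) \<Rightarrow> real mat \<Rightarrow> real mat" where
  "coord_proj n P X = mat n n (\<lambda>(a, b). of_bool (P a b) * X $$ (a, b))"

lemma coord_proj_index: "a < n \<Longrightarrow> b < n \<Longrightarrow> coord_proj n P X $$ (a, b) = of_bool (P a b) * X $$ (a, b)"
  by (simp add: coord_proj_def)

lemma coord_proj_coord_space:
  assumes "X \<in> so n" "\<And>a b. P a b \<Longrightarrow> P b a"
  shows "coord_proj n P X \<in> coord_space n P"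
proof -
  have "coord_proj n P X \<in> so n"
  proof (rule soI)
    fix i j assume "i < n" "j < n"
    then show "coord_proj n P X $$ (j, i) = - coord_proj n P X $$ (i, j)"
      using so_skew[OF assms(1), of i j] assms(2)[of i j] assms(2)[of j i] by (auto simp: coord_proj_index)
  qed (simp add: coord_proj_def)
  then show ?thesis
    by (auto simp: coord_space_def coord_proj_index)
qed

lemma ip_self_eq_0:
  assumes "ip n A A = 0" "a < n" "b < n"
  shows "A $$ (a, b) = 0"
proof -
  have "\<forall>a\<in>{..<n}. (\<Sum>b<n. A $$ (a, b) * A $$ (a, b)) = 0"
    using assms(1) unfolding ip_def by (subst (asm) sum_nonneg_eq_0_iff) (auto intro: sum_nonneg)
  then have "(\<Sum>b<n. A $$ (a, b) * A $$ (a, b)) = 0"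
    using assms by auto
  then have "\<forall>b\<in>{..<n}. A $$ (a, b) * A $$ (a, b) = 0"
    by (subst (asm) sum_nonneg_eq_0_iff) auto
  then show ?thesis
    using assms by auto
qed

lemma so_minus:
  assumes "A \<in> so n" "B \<in> so n"
  shows "A - B \<in> so n"
proof (rule soI)
  fix i j assume "i < n" "j < n"
  then show "(A - B) $$ (j, i) = - (A - B) $$ (i, j)"
    using assms so_skew[OF assms(1), of i j] so_skew[OF assms(2), of i j] by simp
qed (use assms so_carrier in auto)

text \<open>The deleted part is supported off \<open>P\<close>, hence orthogonal to everything
  supported on \<open>P\<close>. For uniqueness, the difference of two candidates is orthogonal to
  itself; n \<ge> 3 makes the factor 2 - n of the Killing form nonzero.\<close>

lemma proj_onto_coord_space:
  assumes n: "3 \<le> n" and X: "X \<in> so n" and P: "\<And>a b. P a b \<Longrightarrow> P b a"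
  shows "proj_onto n (coord_space n P) X = coord_proj n P X"
  unfolding proj_onto_def
proof (rule the_equality)
  have M: "coord_proj n P X \<in> coord_space n P" "coord_proj n P X \<in> so n"
    using coord_proj_coord_space[OF X P] by (auto simp: coord_space_def)
  show "coord_proj n P X \<in> coord_space n P \<and> (\<forall>Z\<in>coord_space n P. killing n (X - coord_proj n P X) Z = 0)"
  proof (intro conjI ballI M)
    fix Z assume Z: "Z \<in> coord_space n P"
    have "(X - coord_proj n P X) $$ (a, b) * Z $$ (a, b) = 0" if "a < n" "b < n" for a b
      using that X M Z by (cases "P a b") (auto simp: coord_space_def coord_proj_index)
    then have "ip n (X - coord_proj n P X) Z = 0"
      unfolding ip_def by (intro sum.neutral ballI) (simp only: lessThan_iff)
    then show "killing n (X - coord_proj n P X) Z = 0"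
      using X M Z by (subst killing_so) (auto intro: so_minus simp: coord_space_def)
  qed
next
  fix A assume A: "A \<in> coord_space n P \<and> (\<forall>Z\<in>coord_space n P. killing n (X - A) Z = 0)"
  let ?D = "coord_proj n P X - A"
  have M: "coord_proj n P X \<in> coord_space n P" "coord_proj n P X \<in> so n" "A \<in> so n"
    using coord_proj_coord_space[OF X P] A by (auto simp: coord_space_def)
  have D: "?D \<in> coord_space n P" "?D \<in> so n"
    using M A so_minus[of "coord_proj n P X" n A] by (auto simp: coord_space_def)
  have "killing n (X - A) ?D = 0"
    using A D by auto
  then have "ip n (X - A) ?D = 0"
    using n by (subst (asm) killing_so) (auto intro: so_minus X M D)
  \<comment> \<open>On \<open>P\<close> the matrix X agrees with its truncation; off
    \<open>P\<close> the entries of \<open>?D\<close> vanish.\<close>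
  also have "ip n (X - A) ?D = ip n ?D ?D"
    using M X A unfolding ip_def by (intro sum.cong) (auto simp: coord_space_def coord_proj_index)
  finally have "?D $$ (a, b) = 0" if "a < n" "b < n" for a b
    using ip_self_eq_0 that by blast
  then show "A = coord_proj n P X"
    using M by (intro eq_matI) auto
qed

lemma so_add:
  assumes "A \<in> so n" "B \<in> so n"
  shows "A + B \<in> so n"
proof (rule soI)
  fix i j assume "i < n" "j < n"
  then show "(A + B) $$ (j, i) = - (A + B) $$ (i, j)"
    using assms so_skew[OF assms(1), of i j] so_skew[OF assms(2), of i j] by simp
qed (use assms so_carrier in auto)

lemma ip_so_unit:
  assumes "i < n" "j < n" "i \<noteq> j"
  shows "ip n A (so_unit n i j) = A $$ (i, j) - A $$ (j, i)"
proof -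
  have "ip n A (so_unit n i j) = (\<Sum>a<n. of_bool (a = i) * A $$ (a, j) - of_bool (a = j) * A $$ (a, i))"
    unfolding ip_def using assms
    by (intro sum.cong refl, subst mult.commute) (simp add: sum_so_unit_times)
  then show ?thesis
    using assms by (simp only: sum_subtractf sum_single_of_bool)
qed

text \<open>Ad-invariance of the trace form, obtained by renaming indices in the triple sums and
  using that X is skew. It isolates the test vector Z in the equation that defines the symmetric
  part of the connection.\<close>

lemma ip_lie_bracket:
  assumes "Z \<in> so n" "X \<in> so n" "W \<in> so n"
  shows "ip n (lie_bracket Z X) W = ip n Z (lie_bracket X W)"
proof -
  note c = assms[THEN so_carrier]
  have "ip n (lie_bracket Z X) W =
      (\<Sum>a<n. \<Sum>b<n. (\<Sum>c<n. Z $$ (a, c) * X $$ (c, b) * W $$ (a, b))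
        - (\<Sum>c<n. X $$ (a, c) * Z $$ (c, b) * W $$ (a, b)))"
    unfolding ip_def by (intro sum.cong refl) (simp add: lie_bracket_index[OF c(1,2)] sum_distrib_right left_diff_distrib)
  also have "\<dots> = (\<Sum>a<n. \<Sum>b<n. \<Sum>c<n. Z $$ (a, c) * X $$ (c, b) * W $$ (a, b))
      - (\<Sum>a<n. \<Sum>b<n. \<Sum>c<n. X $$ (a, c) * Z $$ (c, b) * W $$ (a, b))"
    by (simp only: sum_subtractf)
  also have "(\<Sum>a<n. \<Sum>b<n. \<Sum>c<n. Z $$ (a, c) * X $$ (c, b) * W $$ (a, b)) =
      (\<Sum>a<n. \<Sum>b<n. \<Sum>c<n. Z $$ (a, b) * X $$ (b, c) * W $$ (a, c))"
    by (intro sum.cong[OF refl] sum.swap)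
  also have "\<dots> = - (\<Sum>a<n. \<Sum>b<n. \<Sum>c<n. Z $$ (a, b) * (W $$ (a, c) * X $$ (c, b)))"
    unfolding sum_negf[symmetric]
  proof (intro sum.cong[OF refl])
    fix a b c assume "b \<in> {..<n}" "c \<in> {..<n}"
    then show "Z $$ (a, b) * X $$ (b, c) * W $$ (a, c) = - (Z $$ (a, b) * (W $$ (a, c) * X $$ (c, b)))"
      using so_skew[OF assms(2), of b c] by simp
  qed
  also have "(\<Sum>a<n. \<Sum>b<n. \<Sum>c<n. X $$ (a, c) * Z $$ (c, b) * W $$ (a, b)) =
      (\<Sum>a<n. \<Sum>c<n. \<Sum>b<n. X $$ (a, c) * Z $$ (c, b) * W $$ (a, b))"
    by (intro sum.cong[OF refl] sum.swap)
  also have "\<dots> = (\<Sum>c<n. \<Sum>a<n. \<Sum>b<n. X $$ (a, c) * Z $$ (c, b) * W $$ (a, b))"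
    by (rule sum.swap)
  also have "\<dots> = (\<Sum>a<n. \<Sum>b<n. \<Sum>c<n. X $$ (c, a) * Z $$ (a, b) * W $$ (c, b))"
    by (intro sum.cong[OF refl] sum.swap)
  also have "\<dots> = - (\<Sum>a<n. \<Sum>b<n. \<Sum>c<n. Z $$ (a, b) * (X $$ (a, c) * W $$ (c, b)))"
    unfolding sum_negf[symmetric]
  proof (intro sum.cong[OF refl])
    fix a b c assume "a \<in> {..<n}" "c \<in> {..<n}"
    then show "X $$ (c, a) * Z $$ (a, b) * W $$ (c, b) = - (Z $$ (a, b) * (X $$ (a, c) * W $$ (c, b)))"
      using so_skew[OF assms(2), of a c] by simp
  qed
  also have "- (\<Sum>a<n. \<Sum>b<n. \<Sum>c<n. Z $$ (a, b) * (W $$ (a, c) * X $$ (c, b)))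
      - - (\<Sum>a<n. \<Sum>b<n. \<Sum>c<n. Z $$ (a, b) * (X $$ (a, c) * W $$ (c, b))) =
      ip n Z (lie_bracket X W)"
    unfolding ip_def by (simp add: lie_bracket_index[OF c(2,3)] sum_distrib_left sum_subtractf
        right_diff_distrib cong: sum.cong_simp)
  finally show ?thesis .
qed

subsection \<open>The Levi-Civita connection\<close>

lemma block_cases: "block k l a = 1 \<or> block k l a = 2 \<or> block k l a = 3"
  by (auto simp: block_def)

lemma isotropy_eq: "isotropy k l m = coord_space (k + l + m) (\<lambda>a b. block k l a = block k l b)"
  by (simp add: isotropy_def coord_space_def)

lemma tangent_summand_eq:
  "tangent_summand k l m i =
    coord_space (k + l + m) (\<lambda>a b. {block k l a, block k l b} = {1, 2, 3} - {i})"
  by (simp add: tangent_summand_def coord_space_def)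

text \<open>This is how the block sizes enter the Ricci tensor as coefficients.\<close>

lemma sum_block:
  fixes h :: "nat \<Rightarrow> real"
  shows "(\<Sum>j<k + l + m. h (block k l j)) = real k * h 1 + real l * h 2 + real m * h 3"
proof -
  have "(\<Sum>j<k + l + m. h (block k l j)) =
      (\<Sum>j\<in>{0..<k}. h (block k l j)) + (\<Sum>j\<in>{k..<k + l}. h (block k l j))
      + (\<Sum>j\<in>{k + l..<k + l + m}. h (block k l j))"
    by (simp add: lessThan_atLeast0 sum.atLeastLessThan_concat)
  also have "(\<Sum>j\<in>{0..<k}. h (block k l j)) = (\<Sum>j\<in>{0..<k}. h 1)"
    by (intro sum.cong) (auto simp: block_def)
  also have "(\<Sum>j\<in>{k..<k + l}. h (block k l j)) = (\<Sum>j\<in>{k..<k + l}. h 2)"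
    by (intro sum.cong) (auto simp: block_def)
  also have "(\<Sum>j\<in>{k + l..<k + l + m}. h (block k l j)) = (\<Sum>j\<in>{k + l..<k + l + m}. h 3)"
    by (intro sum.cong) (auto simp: block_def)
  finally show ?thesis
    by simp
qed

locale flag_metric =
  fixes k l m :: nat and x1 x2 x3 :: real
  assumes blocks: "0 < k" "0 < l" "0 < m"
    and params: "0 < x1" "0 < x2" "0 < x3"
begin

abbreviation n :: nat where "n \<equiv> k + l + m"
abbreviation \<beta> :: "nat \<Rightarrow> nat" where "\<beta> \<equiv> block k l"
abbreviation \<pp> :: "real mat set" where "\<pp> \<equiv> tangent k l m"
abbreviation x :: "real \<times> real \<times> real" where "x \<equiv> (x1, x2, x3)"

lemma n_ge_3: "3 \<le> n"
  using blocks by simp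

text \<open>Orthogonality to the elementary matrices of a diagonal block kills the entries of that
  block. Conversely, matrices with disjoint supports are orthogonal.\<close>

lemma tangent_eq: "\<pp> = coord_space n (\<lambda>a b. \<beta> a \<noteq> \<beta> b)"
proof (intro equalityI subsetI)
  fix A assume A: "A \<in> \<pp>"
  then have so: "A \<in> so n"
    by (simp add: tangent_def)
  have "A $$ (a, b) = 0" if ab: "a < n" "b < n" "\<beta> a = \<beta> b" for a b
  proof (cases "a = b")
    case True
    then show ?thesis
      using so_diag[OF so] ab by simp
  next
    case False
    then have "so_unit n a b \<in> isotropy k l m"
      using ab by (auto simp: isotropy_eq coord_space_def so_unit_so so_unit_index)
    then have "killing n A (so_unit n a b) = 0"
      using A by (simp add: tangent_def)
    then have "ip n A (so_unit n a b) = 0"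
      using n_ge_3 by (subst (asm) killing_so) (auto simp: so so_unit_so False)
    then show ?thesis
      using False ab so_skew[OF so ab(1,2)] by (simp add: ip_so_unit)
  qed
  then show "A \<in> coord_space n (\<lambda>a b. \<beta> a \<noteq> \<beta> b)"
    using so by (simp add: coord_space_def)
next
  fix A assume A: "A \<in> coord_space n (\<lambda>a b. \<beta> a \<noteq> \<beta> b)"
  have "killing n A Z = 0" if Z: "Z \<in> isotropy k l m" for Z
  proof -
    have "A $$ (a, b) * Z $$ (a, b) = 0" if "a < n" "b < n" for a b
      using A Z that by (cases "\<beta> a = \<beta> b") (auto simp: isotropy_eq coord_space_def)
    then have "ip n A Z = 0"
      unfolding ip_def by (intro sum.neutral ballI) (simp only: lessThan_iff)
    then show ?thesis
      using A Z by (subst killing_so) (auto simp: isotropy_eq coord_space_def)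
  qed
  then show "A \<in> \<pp>"
    using A by (simp add: tangent_def coord_space_def)
qed

lemma tangent_so: "X \<in> \<pp> \<Longrightarrow> X \<in> so n"
  by (simp add: tangent_def)

lemma tangent_zero: "X \<in> \<pp> \<Longrightarrow> a < n \<Longrightarrow> b < n \<Longrightarrow> \<beta> a = \<beta> b \<Longrightarrow> X $$ (a, b) = 0"
  by (simp add: tangent_eq coord_space_def)

text \<open>For two different blocks, the metric parameter carries the index of the third block, as
  the summands of the tangent space do.\<close>

definition wt :: "nat \<Rightarrow> nat \<Rightarrow> real" where
  "wt s t = (if s = t then 0 else if s \<noteq> 1 \<and> t \<noteq> 1 then x1 else if s \<noteq> 2 \<and> t \<noteq> 2 then x2 else x3)"

abbreviation g :: "nat \<Rightarrow> nat \<Rightarrow> real" where "g a b \<equiv> wt (\<beta> a) (\<beta> b)"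

lemma wt_self [simp]: "wt s s = 0"
  by (simp add: wt_def)

lemma wt_commute: "wt s t = wt t s"
  by (simp add: wt_def)

lemma wt_pos: "s \<noteq> t \<Longrightarrow> wt s t > 0"
  using params by (simp add: wt_def)

lemma wt_eq_0_iff [simp]: "wt s t = 0 \<longleftrightarrow> s = t"
  using wt_pos[of s t] by force

text \<open>The three projections mask disjoint sets of entries, so the three parameters combine
  into one weight per entry. The factor n - 2 is that of the negated Killing form.\<close>

lemma metric_eq:
  assumes X: "X \<in> so n" and Y: "Y \<in> so n"
  shows "metric k l m x X Y = (real n - 2) * (\<Sum>a<n. \<Sum>b<n. g a b * (X $$ (a, b) * Y $$ (a, b)))"
proof -
  define P where "P i a b \<longleftrightarrow> {\<beta> a, \<beta> b} = {1, 2, 3} - {i}" for i a b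
  have sym: "P i b a" if "P i a b" for i a b
    using that by (auto simp: P_def)
  have proj: "proj_onto n (tangent_summand k l m i) W = coord_proj n (P i) W" if "W \<in> so n" for i W
    unfolding tangent_summand_eq P_def[symmetric]
    by (rule proj_onto_coord_space[OF n_ge_3 that sym])
  define T where "T i = (\<Sum>a<n. \<Sum>b<n. of_bool (P i a b) * (X $$ (a, b) * Y $$ (a, b)))" for i
  have kil: "killing n (coord_proj n (P i) X) (coord_proj n (P i) Y) = - (real n - 2) * T i" for i
  proof -
    have M: "coord_proj n (P i) X \<in> so n" "coord_proj n (P i) Y \<in> so n"
      using coord_proj_coord_space[OF X, of "P i"] coord_proj_coord_space[OF Y, of "P i"] sym
      by (auto simp: coord_space_def)
    show ?thesis
      unfolding killing_so[OF M] ip_def T_def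
      by (rule arg_cong2[where f = "(*)"], rule refl, intro sum.cong refl) (auto simp: coord_proj_index)
  qed
  have g: "g a b = x1 * of_bool (P 1 a b) + x2 * of_bool (P 2 a b) + x3 * of_bool (P 3 a b)" for a b
  proof -
    have "P 1 a b \<longleftrightarrow> \<beta> a \<noteq> \<beta> b \<and> \<beta> a \<noteq> 1 \<and> \<beta> b \<noteq> 1"
      "P 2 a b \<longleftrightarrow> \<beta> a \<noteq> \<beta> b \<and> \<beta> a \<noteq> 2 \<and> \<beta> b \<noteq> 2"
      "P 3 a b \<longleftrightarrow> \<beta> a \<noteq> \<beta> b \<and> \<beta> a \<noteq> 3 \<and> \<beta> b \<noteq> 3"
      using block_cases[of k l a] block_cases[of k l b] unfolding P_def
      by (elim disjE; simp add: insert_Diff_if doubleton_eq_iff)+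
    then show ?thesis
      using block_cases[of k l a] block_cases[of k l b] by (auto simp: wt_def)
  qed
  have "(\<Sum>a<n. \<Sum>b<n. g a b * (X $$ (a, b) * Y $$ (a, b))) =
      x1 * T 1 + x2 * T 2 + x3 * T 3"
    unfolding T_def sum_distrib_left sum.distrib[symmetric] g by (simp only: ring_distribs mult.assoc)
  then show ?thesis
    unfolding metric_def Let_def prod.case proj[OF X] proj[OF Y] kil
    by (simp add: algebra_simps)
qed

lemma bracket_p_eq:
  "X \<in> so n \<Longrightarrow> Y \<in> so n \<Longrightarrow> bracket_p k l m X Y = coord_proj n (\<lambda>a b. \<beta> a \<noteq> \<beta> b) (lie_bracket X Y)"
  unfolding bracket_p_def tangent_eq
  by (rule proj_onto_coord_space[OF n_ge_3 lie_bracket_so]) auto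

lemma bracket_h_eq:
  "X \<in> so n \<Longrightarrow> Y \<in> so n \<Longrightarrow> bracket_h k l m X Y = coord_proj n (\<lambda>a b. \<beta> a = \<beta> b) (lie_bracket X Y)"
  unfolding bracket_h_def isotropy_eq
  by (rule proj_onto_coord_space[OF n_ge_3 lie_bracket_so]) auto

lemma bracket_p_tangent: "X \<in> so n \<Longrightarrow> Y \<in> so n \<Longrightarrow> bracket_p k l m X Y \<in> \<pp>"
  by (simp add: bracket_p_eq tangent_eq, rule coord_proj_coord_space[OF lie_bracket_so]) auto

lemma bracket_h_so: "X \<in> so n \<Longrightarrow> Y \<in> so n \<Longrightarrow> bracket_h k l m X Y \<in> so n"
  using coord_proj_coord_space[OF lie_bracket_so, of X n Y "\<lambda>a b. \<beta> a = \<beta> b"]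
  by (auto simp: bracket_h_eq coord_space_def)

text \<open>The operator that represents the metric with respect to the trace form, up to the factor
  n - 2.\<close>

definition wmat :: "real mat \<Rightarrow> real mat" where
  "wmat X = mat n n (\<lambda>(a, b). g a b * X $$ (a, b))"

lemma wmat_index: "a < n \<Longrightarrow> b < n \<Longrightarrow> wmat X $$ (a, b) = g a b * X $$ (a, b)"
  by (simp add: wmat_def)

lemma wmat_so:
  assumes "X \<in> so n"
  shows "wmat X \<in> so n"
proof (rule soI)
  fix i j assume "i < n" "j < n"
  then show "wmat X $$ (j, i) = - wmat X $$ (i, j)"
    using so_skew[OF assms, of i j] by (simp add: wmat_index wt_commute[of "\<beta> j"])
qed (simp add: wmat_def)

text \<open>The projection of [Z, X] can be omitted because \<open>wmat Y\<close> vanishes on the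
  diagonal blocks; invariance of the trace form does the rest.\<close>

lemma metric_bracket_p:
  assumes "Z \<in> so n" "X \<in> so n" "Y \<in> so n"
  shows "metric k l m x (bracket_p k l m Z X) Y = (real n - 2) * ip n Z (lie_bracket X (wmat Y))"
proof -
  have "metric k l m x (bracket_p k l m Z X) Y = (real n - 2) * ip n (lie_bracket Z X) (wmat Y)"
    unfolding metric_eq[OF tangent_so[OF bracket_p_tangent[OF assms(1,2)]] assms(3)] ip_def
    by (rule arg_cong2[where f = "(*)"], rule refl, intro sum.cong refl)
      (auto simp: bracket_p_eq assms coord_proj_index wmat_index)
  then show ?thesis
    by (simp add: ip_lie_bracket assms wmat_so)
qed

lemma metric_commute: "X \<in> so n \<Longrightarrow> Y \<in> so n \<Longrightarrow> metric k l m x X Y = metric k l m x Y X"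
  by (simp add: metric_eq mult.commute)

text \<open>Positive definiteness on the tangent space, from which the uniqueness of
  \<open>lc_sym\<close> follows.\<close>

lemma metric_self_eq_0:
  assumes X: "X \<in> \<pp>" and "metric k l m x X X = 0" "a < n" "b < n"
  shows "X $$ (a, b) = 0"
proof (cases "\<beta> a = \<beta> b")
  case True
  then show ?thesis
    using X assms by (simp add: tangent_zero)
next
  case False
  have nonneg: "g a b * (X $$ (a, b) * X $$ (a, b)) \<ge> 0" for a b
    using wt_pos[of "\<beta> a" "\<beta> b"] by (cases "\<beta> a = \<beta> b") auto
  have "(\<Sum>a<n. \<Sum>b<n. g a b * (X $$ (a, b) * X $$ (a, b))) = 0"
    using assms n_ge_3 by (simp add: metric_eq tangent_so)
  then have "\<forall>a\<in>{..<n}. (\<Sum>b<n. g a b * (X $$ (a, b) * X $$ (a, b))) = 0"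
    using nonneg by (subst (asm) sum_nonneg_eq_0_iff) (auto intro: sum_nonneg)
  then have "(\<Sum>b<n. g a b * (X $$ (a, b) * X $$ (a, b))) = 0"
    using assms by auto
  then have "\<forall>b\<in>{..<n}. g a b * (X $$ (a, b) * X $$ (a, b)) = 0"
    using nonneg by (subst (asm) sum_nonneg_eq_0_iff) auto
  then show ?thesis
    using assms False by auto
qed

text \<open>Within a diagonal block the weight \<open>g\<close> vanishes, and division by zero returns the entry
  \<open>0\<close> that the projection to \<open>\<pp>\<close> requires.\<close>

lemma lc_sym_eq:
  assumes X: "X \<in> \<pp>" and Y: "Y \<in> \<pp>"
  defines "S \<equiv> lie_bracket X (wmat Y) + lie_bracket Y (wmat X)"
  shows "lc_sym k l m x X Y = mat n n (\<lambda>(a, b). S $$ (a, b) / (2 * g a b))" (is "_ = ?V")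
    and "lc_sym k l m x X Y \<in> \<pp>"
proof -
  note so = X[THEN tangent_so] Y[THEN tangent_so]
  have S: "S \<in> so n"
    unfolding S_def using so by (intro so_add lie_bracket_so wmat_so)
  have "?V \<in> so n"
  proof (rule soI)
    fix i j assume "i < n" "j < n"
    then show "?V $$ (j, i) = - ?V $$ (i, j)"
      using so_skew[OF S, of i j] by (simp add: wt_commute[of "\<beta> j"])
  qed simp
  then have V: "?V \<in> \<pp>"
    by (auto simp: tangent_eq coord_space_def)
  have rhs: "metric k l m x (bracket_p k l m Z X) Y + metric k l m x X (bracket_p k l m Z Y) =
      (real n - 2) * ip n Z S" if "Z \<in> \<pp>" for Z
  proof -
    note Z = that[THEN tangent_so]
    have "metric k l m x X (bracket_p k l m Z Y) = metric k l m x (bracket_p k l m Z Y) X"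
      by (intro metric_commute tangent_so[OF bracket_p_tangent] so Z)
    moreover have "ip n Z S = ip n Z (lie_bracket X (wmat Y)) + ip n Z (lie_bracket Y (wmat X))"
      unfolding ip_def sum.distrib[symmetric] S_def
      using lie_bracket_so[OF so(2) wmat_so[OF so(1)]]
      by (intro sum.cong refl) (simp add: distrib_left)
    ultimately show ?thesis
      by (simp add: metric_bracket_p Z so distrib_left)
  qed
  have lhs: "2 * metric k l m x ?V Z = (real n - 2) * ip n Z S" if Z: "Z \<in> \<pp>" for Z
  proof -
    have "2 * metric k l m x ?V Z =
        (real n - 2) * (\<Sum>a<n. \<Sum>b<n. 2 * (g a b * (?V $$ (a, b) * Z $$ (a, b))))"
      unfolding metric_eq[OF V[THEN tangent_so] Z[THEN tangent_so]]
      by (simp only: sum_distrib_left[symmetric] mult.left_commute)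
    also have "\<dots> = (real n - 2) * ip n Z S"
      unfolding ip_def
    proof (rule arg_cong2[where f = "(*)"], rule refl, intro sum.cong refl)
      fix a b assume "a \<in> {..<n}" "b \<in> {..<n}"
      then show "2 * (g a b * (?V $$ (a, b) * Z $$ (a, b))) = Z $$ (a, b) * S $$ (a, b)"
        using Z by (cases "\<beta> a = \<beta> b") (auto simp: tangent_zero)
    qed
    finally show ?thesis .
  qed
  show *: "lc_sym k l m x X Y = ?V"
    unfolding lc_sym_def
  proof (rule the_equality)
    show "?V \<in> \<pp> \<and> (\<forall>Z\<in>\<pp>. 2 * metric k l m x ?V Z =
        metric k l m x (bracket_p k l m Z X) Y + metric k l m x X (bracket_p k l m Z Y))"
      using V lhs rhs by simp
  next
    fix V' assume V': "V' \<in> \<pp> \<and> (\<forall>Z\<in>\<pp>. 2 * metric k l m x V' Z =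
        metric k l m x (bracket_p k l m Z X) Y + metric k l m x X (bracket_p k l m Z Y))"
    let ?D = "V' - ?V"
    have soV: "V' \<in> so n" "?V \<in> so n"
      using V V' tangent_so by blast+
    have soD: "?D \<in> so n"
      by (rule so_minus[OF soV])
    have D: "?D \<in> \<pp>"
      using V V' soD by (auto simp: tangent_eq coord_space_def)
    have "metric k l m x ?D ?D = metric k l m x V' ?D - metric k l m x ?V ?D"
      unfolding metric_eq[OF soD soD] metric_eq[OF soV(1) soD] metric_eq[OF soV(2) soD]
        right_diff_distrib[symmetric] sum_subtractf[symmetric]
      by (rule arg_cong2[where f = "(*)"], rule refl, intro sum.cong refl)
        (use soV in \<open>simp add: algebra_simps\<close>)
    also have "\<dots> = 0"
      using V' lhs[OF D] rhs[OF D] D by auto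
    finally have "?D $$ (a, b) = 0" if "a < n" "b < n" for a b
      using metric_self_eq_0[OF D] that by blast
    then show "V' = ?V"
      using soV by (intro eq_matI) auto
  qed
  show "lc_sym k l m x X Y \<in> \<pp>"
    using V * by simp
qed

text \<open>The coefficient of X_ac Y_cb in the entry (a, b) of the Levi-Civita map, for a, c, b in
  the blocks s, u, t. It is 1/2 from the bracket plus (wt u t - wt s u) / (2 wt s t) from
  \<open>lc_sym\<close>.\<close>

definition cf :: "nat \<Rightarrow> nat \<Rightarrow> nat \<Rightarrow> real" where
  "cf s u t = (wt s t + wt u t - wt s u) / (2 * wt s t)"

abbreviation C :: "nat \<Rightarrow> nat \<Rightarrow> nat \<Rightarrow> real" where "C a c b \<equiv> cf (\<beta> a) (\<beta> c) (\<beta> b)"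

lemma cf_self [simp]: "cf s u s = 0"
  by (simp add: cf_def)

lemma levi_civita_tangent:
  assumes "X \<in> \<pp>" "Y \<in> \<pp>"
  shows "levi_civita k l m x X Y \<in> \<pp>"
proof -
  note p = bracket_p_tangent[OF assms[THEN tangent_so]] and q = lc_sym_eq(2)[OF assms]
  note so = p[THEN tangent_so] q[THEN tangent_so]
  have "levi_civita k l m x X Y \<in> so n"
  proof (rule soI)
    fix i j assume "i < n" "j < n"
    then show "levi_civita k l m x X Y $$ (j, i) = - levi_civita k l m x X Y $$ (i, j)"
      using so_skew[OF so(1), of i j] so_skew[OF so(2), of i j] so
      by (simp add: levi_civita_def)
  qed (use so so_carrier in \<open>auto simp: levi_civita_def\<close>)
  then show ?thesis
    using p q so by (auto simp: levi_civita_def tangent_eq coord_space_def)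
qed

lemma levi_civita_index:
  assumes X: "X \<in> \<pp>" and Y: "Y \<in> \<pp>" and ab: "a < n" "b < n"
  shows "levi_civita k l m x X Y $$ (a, b) =
    (\<Sum>c<n. X $$ (a, c) * (C a c b * Y $$ (c, b))) - (\<Sum>c<n. (C b c a * Y $$ (a, c)) * X $$ (c, b))"
\<comment> \<open>In a diagonal block the right side is zero too, since \<open>cf s u s\<close> is a
  division by zero.\<close>
proof (cases "\<beta> a = \<beta> b")
  case True
  then show ?thesis
    using levi_civita_tangent[OF X Y] ab by (simp add: tangent_zero)
next
  case False
  note so = X[THEN tangent_so] Y[THEN tangent_so]
  note c = so[THEN so_carrier] so[THEN wmat_so, THEN so_carrier]
  have W: "lie_bracket Y (wmat X) \<in> so n" "lc_sym k l m x X Y \<in> so n" "bracket_p k l m X Y \<in> so n"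
    using so lie_bracket_so wmat_so lc_sym_eq(2)[OF X Y] bracket_p_tangent tangent_so by blast+
  have "levi_civita k l m x X Y $$ (a, b) = lie_bracket X Y $$ (a, b) / 2 +
      (lie_bracket X (wmat Y) $$ (a, b) + lie_bracket Y (wmat X) $$ (a, b)) / (2 * g a b)"
    using ab W False unfolding levi_civita_def
    by (simp add: bracket_p_eq[OF so] coord_proj_index lc_sym_eq(1)[OF X Y])
  also have "\<dots> = (g a b * lie_bracket X Y $$ (a, b) +
      lie_bracket X (wmat Y) $$ (a, b) + lie_bracket Y (wmat X) $$ (a, b)) / (2 * g a b)"
    using False by (simp add: field_simps)
  also have "g a b * lie_bracket X Y $$ (a, b) +
      lie_bracket X (wmat Y) $$ (a, b) + lie_bracket Y (wmat X) $$ (a, b) =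
      (\<Sum>c<n. g a b * (X $$ (a, c) * Y $$ (c, b) - Y $$ (a, c) * X $$ (c, b))
        + (X $$ (a, c) * (g c b * Y $$ (c, b)) - g a c * Y $$ (a, c) * X $$ (c, b))
        + (Y $$ (a, c) * (g c b * X $$ (c, b)) - g a c * X $$ (a, c) * Y $$ (c, b)))"
    using ab by (simp add: lie_bracket_index[OF c(1,2)] lie_bracket_index[OF c(1,4)]
        lie_bracket_index[OF c(2,3)] sum.distrib sum_subtractf sum_distrib_left[symmetric] wmat_index
        cong: sum.cong_simp)
  also have "\<dots> / (2 * g a b) = (\<Sum>c<n. X $$ (a, c) * (C a c b * Y $$ (c, b)) - (C b c a * Y $$ (a, c)) * X $$ (c, b))"
    unfolding sum_divide_distrib
  proof (intro sum.cong refl)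
    fix c
    \<comment> \<open>The symmetry of \<open>wt\<close> brings both coefficients to the common
      denominator. They come from 1/2 and -1/2 in the bracket, each shifted by the same term (g c b
      - g a c) / (2 g a b); the second is the negative of \<open>C b c a\<close>.\<close>
    have C: "C a c b = (g a b + g c b - g a c) / (2 * g a b)"
      "C b c a = (g a b + g a c - g c b) / (2 * g a b)"
      unfolding cf_def
      by (simp_all only: wt_commute[of "\<beta> b" "\<beta> a"] wt_commute[of "\<beta> c" "\<beta> a"] wt_commute[of "\<beta> b" "\<beta> c"])
    show "(g a b * (X $$ (a, c) * Y $$ (c, b) - Y $$ (a, c) * X $$ (c, b))
        + (X $$ (a, c) * (g c b * Y $$ (c, b)) - g a c * Y $$ (a, c) * X $$ (c, b))
        + (Y $$ (a, c) * (g c b * X $$ (c, b)) - g a c * X $$ (a, c) * Y $$ (c, b))) / (2 * g a b) =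
        X $$ (a, c) * (C a c b * Y $$ (c, b)) - (C b c a * Y $$ (a, c)) * X $$ (c, b)"
      unfolding C using False by (simp add: field_simps)
  qed
  finally show ?thesis
    by (simp add: sum_subtractf)
qed

end

subsection \<open>The Ricci tensor\<close>

context flag_metric
begin

lemma so_unit_tangent:
  assumes "i < n" "j < n" "\<beta> i \<noteq> \<beta> j"
  shows "so_unit n i j \<in> \<pp>"
proof -
  have "i \<noteq> j"
    using assms by auto
  then show ?thesis
    using assms by (auto simp: tangent_eq coord_space_def so_unit_so so_unit_index)
qed

text \<open>The contribution of the basis vector \<open>so_unit n i j\<close> to the trace splits into two parts
  exchanged by \<open>i \<leftrightarrow> j\<close>, and each part involves only products of corresponding entries of \<open>Y\<close> and
  \<open>Z\<close>; hence the Ricci tensor is diagonal in the entries.\<close>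

definition trace_part :: "real mat \<Rightarrow> real mat \<Rightarrow> nat \<Rightarrow> nat \<Rightarrow> real" where
  "trace_part Y Z i j = (\<Sum>c<n. Y $$ (i, c) * Z $$ (i, c) *
     (of_bool (\<beta> c \<noteq> \<beta> j) * C j c i - C i c j * C j i c + of_bool (\<beta> c = \<beta> j) - of_bool (c = j)))"

lemma curvature_so_unit:
  assumes Y: "Y \<in> \<pp>" and Z: "Z \<in> \<pp>" and ij: "i < n" "j < n" "\<beta> i \<noteq> \<beta> j"
  shows "curvature k l m x (so_unit n i j) Y Z $$ (i, j) = trace_part Y Z i j + trace_part Y Z j i"
proof -
  let ?E = "so_unit n i j"
  note E = so_unit_tangent[OF ij]
  note so = E[THEN tangent_so] Y[THEN tangent_so] Z[THEN tangent_so]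
  have ne: "i \<noteq> j"
    using ij by auto
  note unit = sum_times_so_unit[OF ij(1,2) ne] sum_so_unit_times[OF ij(1,2) ne]
  define F where "F = bracket_p k l m ?E Y"
  define G where "G = bracket_h k l m ?E Y"
  have F: "F \<in> \<pp>"
    unfolding F_def by (rule bracket_p_tangent[OF so(1,2)])
  have G: "G \<in> so n"
    unfolding G_def by (rule bracket_h_so[OF so(1,2)])
  note YZ = levi_civita_tangent[OF Y Z] and EZ = levi_civita_tangent[OF E Z]
  \<comment> \<open>Only row i and column j of [E, Y] contribute to the entry (i, j) of the last two
    curvature terms.\<close>
  have EY: "lie_bracket ?E Y $$ (i, c) = Y $$ (j, c) + of_bool (c = i) * Y $$ (i, j)"
    "lie_bracket ?E Y $$ (c, j) = - of_bool (c = j) * Y $$ (i, j) - Y $$ (c, i)" if "c < n" for c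
    using that ij ne so_diag[OF so(2)]
    by (simp_all add: lie_bracket_index[OF so_carrier[OF so(1)] so_carrier[OF so(2)]] unit)
  \<comment> \<open>Row i of E meets only the diagonal entry (j, j) of the other factor, and column
    j of E only the entry (i, i). Both vanish by skewness.\<close>
  have t1: "levi_civita k l m x ?E (levi_civita k l m x Y Z) $$ (i, j) = 0"
    using ij ne so_diag[OF YZ[THEN tangent_so]] by (simp add: levi_civita_index[OF E YZ] unit)
  have EZ_index: "levi_civita k l m x ?E Z $$ (c, j) = - C j i c * Z $$ (c, i)"
    "levi_civita k l m x ?E Z $$ (i, c) = C i j c * Z $$ (j, c)" if "c < n" for c
    using that ij ne so_diag[OF so(3)] by (auto simp add: levi_civita_index[OF E Z] unit)
  have t2: "levi_civita k l m x Y (levi_civita k l m x ?E Z) $$ (i, j) =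
      (\<Sum>c<n. C i c j * C j i c * (Y $$ (i, c) * Z $$ (i, c))
        + C j c i * C i j c * (Y $$ (j, c) * Z $$ (j, c)))"
    unfolding levi_civita_index[OF Y EZ ij(1,2)] sum_subtractf[symmetric]
  proof (intro sum.cong refl)
    fix c assume "c \<in> {..<n}"
    then have c: "c < n" "Z $$ (c, i) = - Z $$ (i, c)" "Y $$ (c, j) = - Y $$ (j, c)"
      using so_skew[OF so(3), of i c] so_skew[OF so(2), of j c] ij by simp_all
    show "Y $$ (i, c) * (C i c j * levi_civita k l m x ?E Z $$ (c, j)) -
        C j c i * levi_civita k l m x ?E Z $$ (i, c) * Y $$ (c, j) =
        C i c j * C j i c * (Y $$ (i, c) * Z $$ (i, c)) + C j c i * C i j c * (Y $$ (j, c) * Z $$ (j, c))"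
      unfolding EZ_index[OF c(1)] c(2,3) by (simp add: algebra_simps)
  qed
  have t3: "levi_civita k l m x F Z $$ (i, j) =
      - (\<Sum>c<n. of_bool (\<beta> i \<noteq> \<beta> c) * C i c j * (Y $$ (j, c) * Z $$ (j, c))
        + of_bool (\<beta> c \<noteq> \<beta> j) * C j c i * (Y $$ (i, c) * Z $$ (i, c)))"
    unfolding levi_civita_index[OF F Z ij(1,2)] sum_subtractf[symmetric] sum_negf[symmetric]
  proof (intro sum.cong refl)
    fix c assume "c \<in> {..<n}"
    then have c: "c < n" "Z $$ (c, j) = - Z $$ (j, c)" "Y $$ (c, i) = - Y $$ (i, c)"
      using so_skew[OF so(3), of j c] so_skew[OF so(2), of i c] ij by simp_all
    have "F $$ (i, c) = of_bool (\<beta> i \<noteq> \<beta> c) * Y $$ (j, c)"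
      "F $$ (c, j) = of_bool (\<beta> c \<noteq> \<beta> j) * Y $$ (i, c)"
      using c ij unfolding F_def bracket_p_eq[OF so(1,2)]
      by (auto simp: coord_proj_index EY c(3))
    then show "F $$ (i, c) * (C i c j * Z $$ (c, j)) - C j c i * Z $$ (i, c) * F $$ (c, j) =
        - (of_bool (\<beta> i \<noteq> \<beta> c) * C i c j * (Y $$ (j, c) * Z $$ (j, c))
        + of_bool (\<beta> c \<noteq> \<beta> j) * C j c i * (Y $$ (i, c) * Z $$ (i, c)))"
      using c(2) by (simp add: algebra_simps)
  qed
  have t4: "lie_bracket G Z $$ (i, j) =
      - (\<Sum>c<n. (of_bool (\<beta> i = \<beta> c) - of_bool (c = i)) * (Y $$ (j, c) * Z $$ (j, c))
        + (of_bool (\<beta> c = \<beta> j) - of_bool (c = j)) * (Y $$ (i, c) * Z $$ (i, c)))"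
    unfolding lie_bracket_index[OF so_carrier[OF G] so_carrier[OF so(3)] ij(1,2)]
      sum_subtractf[symmetric] sum_negf[symmetric]
  proof (intro sum.cong refl)
    fix c assume "c \<in> {..<n}"
    then have c: "c < n" "Z $$ (c, j) = - Z $$ (j, c)" "Y $$ (c, i) = - Y $$ (i, c)"
      using so_skew[OF so(3), of j c] so_skew[OF so(2), of i c] ij by simp_all
    \<comment> \<open>At c = i the bracket has the diagonal entry Y_ij + Y_ji = 0, and similarly at
      c = j; hence the subtracted indicators.\<close>
    have Gc: "G $$ (i, c) = (of_bool (\<beta> i = \<beta> c) - of_bool (c = i)) * Y $$ (j, c)"
      "G $$ (c, j) = (of_bool (\<beta> c = \<beta> j) - of_bool (c = j)) * Y $$ (i, c)"
      using c ij so_skew[OF so(2) ij(1,2)] unfolding G_def bracket_h_eq[OF so(1,2)]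
      by (auto simp: coord_proj_index EY)
    show "G $$ (i, c) * Z $$ (c, j) - Z $$ (i, c) * G $$ (c, j) =
        - ((of_bool (\<beta> i = \<beta> c) - of_bool (c = i)) * (Y $$ (j, c) * Z $$ (j, c))
        + (of_bool (\<beta> c = \<beta> j) - of_bool (c = j)) * (Y $$ (i, c) * Z $$ (i, c)))"
      unfolding Gc c(2) by (simp only: ring_distribs minus_mult_left[symmetric] minus_mult_right[symmetric]) simp
  qed
  note dims = levi_civita_tangent[OF E YZ, THEN tangent_so] levi_civita_tangent[OF Y EZ, THEN tangent_so]
    levi_civita_tangent[OF F Z, THEN tangent_so] lie_bracket_so[OF G so(3)]
  have "curvature k l m x ?E Y Z $$ (i, j) =
      levi_civita k l m x ?E (levi_civita k l m x Y Z) $$ (i, j)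
      - levi_civita k l m x Y (levi_civita k l m x ?E Z) $$ (i, j)
      - levi_civita k l m x F Z $$ (i, j) - lie_bracket G Z $$ (i, j)"
    using ij dims unfolding curvature_def F_def[symmetric] G_def[symmetric] by simp
  also have "\<dots> = trace_part Y Z i j + trace_part Y Z j i"
    unfolding t1 t2 t3 t4 trace_part_def diff_0 diff_minus_eq_add
    unfolding sum_negf[symmetric] sum.distrib[symmetric]
  proof (intro sum.cong refl)
    fix c
    have *: "of_bool (\<beta> i \<noteq> \<beta> c) = of_bool (\<beta> c \<noteq> \<beta> i)" "of_bool (\<beta> i = \<beta> c) = of_bool (\<beta> c = \<beta> i)"
      by auto
    show "- (C i c j * C j i c * (Y $$ (i, c) * Z $$ (i, c)) + C j c i * C i j c * (Y $$ (j, c) * Z $$ (j, c))) +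
        (of_bool (\<beta> i \<noteq> \<beta> c) * C i c j * (Y $$ (j, c) * Z $$ (j, c)) +
         of_bool (\<beta> c \<noteq> \<beta> j) * C j c i * (Y $$ (i, c) * Z $$ (i, c))) +
        ((of_bool (\<beta> i = \<beta> c) - of_bool (c = i)) * (Y $$ (j, c) * Z $$ (j, c)) +
         (of_bool (\<beta> c = \<beta> j) - of_bool (c = j)) * (Y $$ (i, c) * Z $$ (i, c))) =
        Y $$ (i, c) * Z $$ (i, c) *
        (of_bool (\<beta> c \<noteq> \<beta> j) * C j c i - C i c j * C j i c + of_bool (\<beta> c = \<beta> j) - of_bool (c = j)) +
        Y $$ (j, c) * Z $$ (j, c) *
        (of_bool (\<beta> c \<noteq> \<beta> i) * C i c j - C j c i * C i j c + of_bool (\<beta> c = \<beta> i) - of_bool (c = i))"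
      unfolding * by (simp only: ring_distribs) (simp only: ac_simps)
  qed
  finally show ?thesis .
qed

text \<open>For distinct blocks with third block i this is (n - 2) x_i r_i, where r_i is the Ricci
  eigenvalue on the summand i. The factors arise because the tensor is expressed through plain
  products of entries.\<close>

definition ric_coeff :: "nat \<Rightarrow> nat \<Rightarrow> real" where
  "ric_coeff s t = (if s = t then 0 else (real n - 2) / 2 +
     (if s \<noteq> 1 \<and> t \<noteq> 1 then real k * (x1\<^sup>2 - x2\<^sup>2 - x3\<^sup>2) / (4 * x2 * x3)
      else if s \<noteq> 2 \<and> t \<noteq> 2 then real l * (x2\<^sup>2 - x1\<^sup>2 - x3\<^sup>2) / (4 * x1 * x3)
      else real m * (x3\<^sup>2 - x1\<^sup>2 - x2\<^sup>2) / (4 * x1 * x2)))"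

text \<open>After the trace is written as a double sum over i and j, summing over j first leaves a
  coefficient of Y_ic Z_ic that depends only on the blocks of i and c.\<close>

lemma ricci_eq:
  assumes Y: "Y \<in> \<pp>" and Z: "Z \<in> \<pp>"
  shows "ricci k l m x Y Z = (\<Sum>a<n. \<Sum>b<n. ric_coeff (\<beta> a) (\<beta> b) * (Y $$ (a, b) * Z $$ (a, b)))"
proof -
  define w where "w a b = Y $$ (a, b) * Z $$ (a, b)" for a b
  have w_sym: "w b a = w a b" if "a < n" "b < n" for a b
    using so_skew[OF Y[THEN tangent_so] that] so_skew[OF Z[THEN tangent_so] that] by (simp add: w_def)
  have w_zero: "w a b = 0" if "a < n" "b < n" "\<beta> a = \<beta> b" for a b
    using that Y by (simp add: w_def tangent_zero)
  \<comment> \<open>\<open>h\<close> depends only on blocks, so \<open>sum_block\<close> applies to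
    it. The excluded index j = c is kept apart and produces the -1 in \<open>K\<close>.\<close>
  define h where "h s u t = of_bool (s \<noteq> t) *
    (of_bool (u \<noteq> t) * cf t u s - cf s u t * cf t s u + of_bool (u = t))" for s u t
  define K where "K s u = real k * h s u 1 + real l * h s u 2 + real m * h s u 3 - 1" for s u
  have "ricci k l m x Y Z = (\<Sum>(i, j) | i < j \<and> j < n \<and> \<beta> i \<noteq> \<beta> j. trace_part Y Z i j + trace_part Y Z j i)"
    unfolding ricci_def trace_on_def by (intro sum.cong) (auto simp: curvature_so_unit[OF Y Z])
  also have "\<dots> = (\<Sum>i<n. \<Sum>j<n. of_bool (\<beta> i \<noteq> \<beta> j) * trace_part Y Z i j)"
    by (rule sum_unordered_pairs) auto
  also have "\<dots> = (\<Sum>i<n. \<Sum>j<n. \<Sum>c<n. w i c * (h (\<beta> i) (\<beta> c) (\<beta> j) - of_bool (j = c)))"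
    unfolding trace_part_def sum_distrib_left
  proof (intro sum.cong refl)
    fix i j c assume "i \<in> {..<n}" "j \<in> {..<n}" "c \<in> {..<n}"
    then show "of_bool (\<beta> i \<noteq> \<beta> j) * (Y $$ (i, c) * Z $$ (i, c) *
        (of_bool (\<beta> c \<noteq> \<beta> j) * C j c i - C i c j * C j i c + of_bool (\<beta> c = \<beta> j) - of_bool (c = j))) =
        w i c * (h (\<beta> i) (\<beta> c) (\<beta> j) - of_bool (j = c))"
      using w_zero[of i c] by (auto simp: h_def w_def)
  qed
  also have "\<dots> = (\<Sum>i<n. \<Sum>c<n. \<Sum>j<n. w i c * (h (\<beta> i) (\<beta> c) (\<beta> j) - of_bool (j = c)))"
    by (intro sum.cong[OF refl] sum.swap)
  also have "\<dots> = (\<Sum>i<n. \<Sum>c<n. w i c * K (\<beta> i) (\<beta> c))"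
  proof (intro sum.cong refl)
    fix i c assume c: "c \<in> {..<n}"
    have "(\<Sum>j<n. h (\<beta> i) (\<beta> c) (\<beta> j) - of_bool (j = c)) = K (\<beta> i) (\<beta> c)"
      using c sum_block[of "h (\<beta> i) (\<beta> c)" k l m] sum_single_of_bool[of c n "\<lambda>_. 1"]
      by (simp add: K_def sum_subtractf)
    then show "(\<Sum>j<n. w i c * (h (\<beta> i) (\<beta> c) (\<beta> j) - of_bool (j = c))) = w i c * K (\<beta> i) (\<beta> c)"
      by (simp only: sum_distrib_left[symmetric])
  qed
  finally have *: "ricci k l m x Y Z = (\<Sum>a<n. \<Sum>b<n. w a b * K (\<beta> a) (\<beta> b))" .
  \<comment> \<open>\<open>K\<close> need not be symmetric, but \<open>w\<close> is. Averaging over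
    the exchange of a and b leaves only the symmetric part of \<open>K\<close>.\<close>
  also have "\<dots> = (\<Sum>a<n. \<Sum>b<n. w b a * K (\<beta> b) (\<beta> a))"
    by (rule sum.swap)
  also have "\<dots> = (\<Sum>a<n. \<Sum>b<n. w a b * K (\<beta> b) (\<beta> a))"
    by (intro sum.cong refl) (simp add: w_sym)
  finally have "2 * ricci k l m x Y Z = (\<Sum>a<n. \<Sum>b<n. w a b * (K (\<beta> a) (\<beta> b) + K (\<beta> b) (\<beta> a)))"
    using * by (simp only: distrib_left sum.distrib mult_2)
  also have "\<dots> = (\<Sum>a<n. \<Sum>b<n. 2 * (ric_coeff (\<beta> a) (\<beta> b) * w a b))"
  proof (intro sum.cong refl)
    fix a b assume ab: "a \<in> {..<n}" "b \<in> {..<n}"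
    have K: "K s u + K u s = 2 * ric_coeff s u" if "s \<noteq> u" "s \<in> {1, 2, 3}" "u \<in> {1, 2, 3}" for s u
      using that params
      by (elim insertE emptyE; simp add: K_def h_def cf_def wt_def ric_coeff_def; 
          simp add: field_simps power2_eq_square)
    show "w a b * (K (\<beta> a) (\<beta> b) + K (\<beta> b) (\<beta> a)) = 2 * (ric_coeff (\<beta> a) (\<beta> b) * w a b)"
      using w_zero[of a b] K[of "\<beta> a" "\<beta> b"] ab block_cases[of k l a] block_cases[of k l b]
      by (cases "\<beta> a = \<beta> b") auto
  qed
  finally show ?thesis
    by (simp only: w_def sum_distrib_left[symmetric])
qed

end

section \<open>The Einstein condition as equations in the parameters\<close>

lemma sum_so_unit_square:
  assumes "i < n" "j < n" "i \<noteq> j"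
  shows "(\<Sum>a<n. \<Sum>b<n. f a b * (so_unit n i j $$ (a, b) * so_unit n i j $$ (a, b))) = f i j + f j i"
proof -
  have "(\<Sum>a<n. \<Sum>b<n. f a b * (so_unit n i j $$ (a, b) * so_unit n i j $$ (a, b))) =
      (\<Sum>a<n. of_bool (a = i) * (\<Sum>b<n. of_bool (b = j) * f a b)
        + of_bool (a = j) * (\<Sum>b<n. of_bool (b = i) * f a b))"
    unfolding sum_distrib_left sum.distrib[symmetric] using assms
    by (intro sum.cong refl) (auto simp: so_unit_index)
  then show ?thesis
    using assms by (simp only: sum.distrib sum_single_of_bool)
qed

context flag_metric
begin

text \<open>Both tensors are diagonal in the entries, so they are proportional exactly when their
  coefficients are; elementary matrices detect these. The constants on the two sides differ by the
  factor n - 2.\<close>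

lemma einstein_iff:
  "(\<exists>c. \<forall>X\<in>\<pp>. \<forall>Y\<in>\<pp>. ricci k l m x X Y = c * metric k l m x X Y) \<longleftrightarrow>
    (\<exists>c. ric_coeff 2 3 = c * x1 \<and> ric_coeff 1 3 = c * x2 \<and> ric_coeff 1 2 = c * x3)"
    (is "?L \<longleftrightarrow> ?R")
proof
  assume ?L
  then obtain c where c: "\<And>X Y. X \<in> \<pp> \<Longrightarrow> Y \<in> \<pp> \<Longrightarrow> ricci k l m x X Y = c * metric k l m x X Y"
    by blast
  have *: "ric_coeff (\<beta> i) (\<beta> j) = c * (real n - 2) * g i j" if "i < n" "j < n" "\<beta> i \<noteq> \<beta> j" for i j
  proof -
    have ne: "i \<noteq> j"
      using that by auto
    note E = so_unit_tangent[OF that]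
    have "ric_coeff (\<beta> i) (\<beta> j) + ric_coeff (\<beta> j) (\<beta> i) = c * ((real n - 2) * (g i j + g j i))"
      using c[OF E E]
      by (simp only: ricci_eq[OF E E] metric_eq[OF E[THEN tangent_so] E[THEN tangent_so]]
          sum_so_unit_square[OF that(1,2) ne])
    moreover have "ric_coeff (\<beta> j) (\<beta> i) = ric_coeff (\<beta> i) (\<beta> j)"
      by (auto simp: ric_coeff_def)
    ultimately show ?thesis
      by (simp add: wt_commute[of "\<beta> j"])
  qed
  \<comment> \<open>The first index of each block, available because all blocks are
    nonempty.\<close>
  have "\<beta> 0 = 1" "\<beta> k = 2" "\<beta> (k + l) = 3"
    using blocks by (auto simp: block_def)
  then show ?R
    using *[of k "k + l"] *[of 0 "k + l"] *[of 0 k] blocks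
    by (intro exI[of _ "c * (real n - 2)"]) (simp add: wt_def)
next
  assume ?R
  then obtain c where c: "ric_coeff 2 3 = c * x1" "ric_coeff 1 3 = c * x2" "ric_coeff 1 2 = c * x3"
    by blast
  have *: "ric_coeff (\<beta> a) (\<beta> b) = c / (real n - 2) * ((real n - 2) * g a b)" for a b
    using c n_ge_3 block_cases[of k l a] block_cases[of k l b]
    by (auto simp: ric_coeff_def wt_def)
  show ?L
  proof (intro exI[of _ "c / (real n - 2)"] ballI)
    fix X Y assume "X \<in> \<pp>" "Y \<in> \<pp>"
    then show "ricci k l m x X Y = c / (real n - 2) * metric k l m x X Y"
      unfolding ricci_eq[OF \<open>X \<in> \<pp>\<close> \<open>Y \<in> \<pp>\<close>] metric_eq[OF \<open>X \<in> \<pp>\<close>[THEN tangent_so] \<open>Y \<in> \<pp>\<close>[THEN tangent_so]]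
        sum_distrib_left
      by (intro sum.cong refl) (simp only: * mult.assoc)
  qed
qed

text \<open>Multiplying the equation with right side c x_i by four times the other two parameters
  gives all three equations the right side 4 c x1 x2 x3.\<close>

lemma ric_coeff_proportional_iff:
  defines "N \<equiv> 2 * (real n - 2)"
  defines "f1 \<equiv> N * x2 * x3 + real k * (x1\<^sup>2 - x2\<^sup>2 - x3\<^sup>2)"
    and "f2 \<equiv> N * x1 * x3 + real l * (x2\<^sup>2 - x1\<^sup>2 - x3\<^sup>2)"
    and "f3 \<equiv> N * x1 * x2 + real m * (x3\<^sup>2 - x1\<^sup>2 - x2\<^sup>2)"
  shows "(\<exists>c. ric_coeff 2 3 = c * x1 \<and> ric_coeff 1 3 = c * x2 \<and> ric_coeff 1 2 = c * x3) \<longleftrightarrow>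
    f1 = f2 \<and> f2 = f3"
proof -
  have r: "ric_coeff 2 3 = f1 / (4 * x2 * x3)" "ric_coeff 1 3 = f2 / (4 * x1 * x3)"
    "ric_coeff 1 2 = f3 / (4 * x1 * x2)"
    using params unfolding ric_coeff_def f1_def f2_def f3_def N_def
    by (simp_all add: add_divide_distrib)
  have iff: "ric_coeff 2 3 = c * x1 \<longleftrightarrow> f1 = 4 * c * (x1 * x2 * x3)"
    "ric_coeff 1 3 = c * x2 \<longleftrightarrow> f2 = 4 * c * (x1 * x2 * x3)"
    "ric_coeff 1 2 = c * x3 \<longleftrightarrow> f3 = 4 * c * (x1 * x2 * x3)" for c
    unfolding r using params by (auto simp: field_simps)
  show ?thesis
    unfolding iff
  proof
    assume "f1 = f2 \<and> f2 = f3"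
    then show "\<exists>c. f1 = 4 * c * (x1 * x2 * x3) \<and> f2 = 4 * c * (x1 * x2 * x3) \<and> f3 = 4 * c * (x1 * x2 * x3)"
      using params by (intro exI[of _ "f1 / (4 * (x1 * x2 * x3))"]) simp
  qed auto
qed

end

lemma einstein_metrics_iff:
  fixes k l m :: nat
  assumes "0 < k" "0 < l" "0 < m"
  defines "N \<equiv> 2 * (real (k + l + m) - 2)"
  shows "(x1, x2, x3) \<in> einstein_metrics k l m \<longleftrightarrow>
    0 < x1 \<and> 0 < x2 \<and> 0 < x3 \<and>
    N * x2 * x3 + real k * (x1\<^sup>2 - x2\<^sup>2 - x3\<^sup>2) = N * x1 * x3 + real l * (x2\<^sup>2 - x1\<^sup>2 - x3\<^sup>2) \<and>
    N * x1 * x3 + real l * (x2\<^sup>2 - x1\<^sup>2 - x3\<^sup>2) = N * x1 * x2 + real m * (x3\<^sup>2 - x1\<^sup>2 - x2\<^sup>2)"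
proof (cases "0 < x1 \<and> 0 < x2 \<and> 0 < x3")
  case True
  then interpret flag_metric k l m x1 x2 x3
    using assms by unfold_locales auto
  show ?thesis
    using True einstein_iff ric_coeff_proportional_iff
    by (simp add: einstein_metrics_def N_def)
qed (auto simp: einstein_metrics_def)

subsection \<open>Counting Einstein metrics\<close>

lemma equiv_homothety: "equiv UNIV homothety"
proof (rule equivI)
  show "refl homothety"
    by (auto simp: refl_on_def homothety_def intro!: exI[of _ 1])
  show "sym homothety"
  proof (rule symI)
    fix x y assume "(x, y) \<in> homothety"
    then obtain c x1 x2 x3 where "c > 0" "x = (x1, x2, x3)" "y = (c * x1, c * x2, c * x3)"
      by (auto simp: homothety_def)
    then show "(y, x) \<in> homothety"
      by (auto simp: homothety_def intro!: exI[of _ "inverse c"])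
  qed
  show "trans homothety"
  proof (rule transI)
    fix x y z assume "(x, y) \<in> homothety" "(y, z) \<in> homothety"
    then obtain c d x1 x2 x3 where "c > 0" "d > 0" "x = (x1, x2, x3)" "y = (c * x1, c * x2, c * x3)"
      "z = (d * (c * x1), d * (c * x2), d * (c * x3))"
      by (auto simp: homothety_def)
    then show "(x, z) \<in> homothety"
      by (auto simp: homothety_def intro!: exI[of _ "d * c"])
  qed
qed simp

text \<open>Sending a representative to its class is a bijection, so counting metrics up to
  homothety amounts to listing one triple per ray.\<close>

lemma card_quotient_representatives:
  assumes h: "equiv UNIV h" and "R \<subseteq> E"
    and cover: "\<And>x. x \<in> E \<Longrightarrow> \<exists>r\<in>R. (r, x) \<in> h"
    and sep: "\<And>r s. r \<in> R \<Longrightarrow> s \<in> R \<Longrightarrow> (r, s) \<in> h \<Longrightarrow> r = s"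
  shows "card (E // h) = card R"
proof -
  have "bij_betw (\<lambda>r. h `` {r}) R (E // h)"
  proof (rule bij_betwI')
    fix r s assume "r \<in> R" "s \<in> R"
    then show "(h `` {r} = h `` {s}) = (r = s)"
      using sep eq_equiv_class_iff[OF h, of r s] by auto
  next
    fix r assume "r \<in> R"
    then show "h `` {r} \<in> E // h"
      using \<open>R \<subseteq> E\<close> by (auto intro: quotientI)
  next
    fix Q assume "Q \<in> E // h"
    then obtain x where x: "x \<in> E" "Q = h `` {x}"
      by (auto elim: quotientE)
    then obtain r where r: "r \<in> R" "(r, x) \<in> h"
      using cover by blast
    then show "\<exists>r\<in>R. Q = h `` {r}"
      using x equiv_class_eq[OF h r(2)] by auto
  qed
  then show ?thesis
    by (simp add: bij_betw_same_card)
qed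

lemma homothetyI:
  "c > 0 \<Longrightarrow> y1 = c * x1 \<Longrightarrow> y2 = c * x2 \<Longrightarrow> y3 = c * x3 \<Longrightarrow> ((x1, x2, x3), (y1, y2, y3)) \<in> homothety"
  by (auto simp: homothety_def)

text \<open>The vanishing cross product removes the unknown factor c; it serves to tell
  representatives apart.\<close>

lemma homothety_cross:
  assumes "((x1, x2, x3), (y1, y2, y3)) \<in> homothety"
  shows "x1 * y2 = x2 * y1 \<and> x1 * y3 = x3 * y1 \<and> x2 * y3 = x3 * y2"
  using assms by (auto simp: homothety_def)

text \<open>With two equal blocks, f2 - f3 changes sign when x2 and x3 are exchanged, so it contains
  the factor x2 - x3, and the cofactor is linear. The two alternatives are the zero sets of these
  factors, each combined with f1 = f2.\<close>

lemma einstein_metrics_equal_blocks_iff: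
  fixes k l :: nat
  assumes "0 < k" "0 < l"
  defines "K \<equiv> real k" and "L \<equiv> real l"
  shows "(x1, x2, x3) \<in> einstein_metrics k l l \<longleftrightarrow>
    0 < x1 \<and> 0 < x2 \<and> 0 < x3 \<and>
    (x2 = x3 \<and> (K + L) * x1\<^sup>2 + 4 * (L - 1) * x2\<^sup>2 = 2 * (K + 2 * L - 2) * x1 * x2 \<or>
     (K + 2 * L - 2) * x1 = L * (x2 + x3) \<and>
       (4 * K + 4 * L - 4) * (x2 * x3) = (K + L) * ((x2 + x3)\<^sup>2 - x1\<^sup>2))"
proof -
  define N where "N = 2 * (K + 2 * L - 2)"
  define f1 f2 f3 where "f1 = N * x2 * x3 + K * (x1\<^sup>2 - x2\<^sup>2 - x3\<^sup>2)"
    and "f2 = N * x1 * x3 + L * (x2\<^sup>2 - x1\<^sup>2 - x3\<^sup>2)"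
    and "f3 = N * x1 * x2 + L * (x3\<^sup>2 - x1\<^sup>2 - x2\<^sup>2)"
  have N: "2 * (real (k + l + l) - 2) = N"
    by (simp add: N_def K_def L_def)
  have "f2 - f3 = 2 * (x2 - x3) * (L * (x2 + x3) - (K + 2 * L - 2) * x1)"
    by (simp add: f2_def f3_def N_def power2_eq_square algebra_simps)
  then have 23: "f2 = f3 \<longleftrightarrow> x2 = x3 \<or> (K + 2 * L - 2) * x1 = L * (x2 + x3)"
    by auto
  have 12: "f1 - f2 = (K + L) * x1\<^sup>2 + 4 * (L - 1) * x2\<^sup>2 - 2 * (K + 2 * L - 2) * x1 * x2" if "x2 = x3"
    using that by (simp add: f1_def f2_def N_def power2_eq_square algebra_simps)
  have other: "f1 - f2 = (4 * K + 4 * L - 4) * (x2 * x3) - (K + L) * ((x2 + x3)\<^sup>2 - x1\<^sup>2)"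
    if "(K + 2 * L - 2) * x1 = L * (x2 + x3)"
  proof -
    \<comment> \<open>The linear relation eliminates the mixed term x1 x3 from
      \<open>f2\<close>.\<close>
    have "N * x1 = 2 * (L * (x2 + x3))"
      using that unfolding N_def by (simp only: mult.assoc)
    then have "f2 = 2 * (L * (x2 + x3)) * x3 + L * (x2\<^sup>2 - x1\<^sup>2 - x3\<^sup>2)"
      by (simp only: f2_def)
    then show ?thesis
      by (simp add: f1_def N_def power2_eq_square algebra_simps)
  qed
  show ?thesis
    unfolding einstein_metrics_iff[OF assms(1,2,2)] N K_def[symmetric] L_def[symmetric]
      f1_def[symmetric] f2_def[symmetric] f3_def[symmetric] 23
    using 12 other by auto
qed

lemma card_einstein_2:
  fixes k :: nat
  assumes "3 \<le> k"
  shows "card (einstein_metrics k 2 2 // homothety) = 2"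
proof -
  define K where "K = real k"
  \<comment> \<open>Completing the square in the first alternative gives (K + 2) (y - 1)^2 = K - 2
    for y = x1 / x2, with roots 1 + d and 1 - d.\<close>
  define d where "d = sqrt ((K - 2) / (K + 2))"
  have K: "K \<ge> 3"
    using assms by (simp add: K_def)
  have d2: "d\<^sup>2 * (K + 2) = K - 2"
    using K by (simp add: d_def)
  have d: "0 < d" "d < 1"
    using K by (auto simp: d_def)
  have iff: "(x1, x2, x3) \<in> einstein_metrics k 2 2 \<longleftrightarrow>
    0 < x1 \<and> 0 < x2 \<and> 0 < x3 \<and>
    (x2 = x3 \<and> (K + 2) * x1\<^sup>2 + 4 * x2\<^sup>2 = 2 * (K + 2) * x1 * x2 \<or>
     (K + 2) * x1 = 2 * (x2 + x3) \<and>
       (4 * K + 4) * (x2 * x3) = (K + 2) * ((x2 + x3)\<^sup>2 - x1\<^sup>2))" for x1 x2 x3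
  proof -
    have "K + 2 * real 2 - 2 = K + 2" "4 * (real 2 - 1) = 4" "4 * K + 4 * real 2 - 4 = 4 * K + 4"
      "real 2 = 2"
      by simp_all
    moreover have "0 < k" "0 < (2 :: nat)"
      using assms by simp_all
    ultimately show ?thesis
      using einstein_metrics_equal_blocks_iff[of k 2 x1 x2 x3, folded K_def] by (simp only:)
  qed
  let ?R = "{(1 + d, 1, 1), (1 - d, 1, 1)} :: (real \<times> real \<times> real) set"
  have "card (einstein_metrics k 2 2 // homothety) = card ?R"
  proof (rule card_quotient_representatives[OF equiv_homothety])
    have "(K + 2) * (1 + d)\<^sup>2 + 4 = 2 * (K + 2) * (1 + d)" "(K + 2) * (1 - d)\<^sup>2 + 4 = 2 * (K + 2) * (1 - d)"
      using d2 by (simp_all add: algebra_simps power2_eq_square)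
    then show "?R \<subseteq> einstein_metrics k 2 2"
      using d by (simp add: iff)
  next
    fix x assume "x \<in> einstein_metrics k 2 2"
    moreover obtain x1 x2 x3 where x: "x = (x1, x2, x3)"
      by (cases x) auto
    ultimately have pos: "0 < x1" "0 < x2" "0 < x3"
      and "x2 = x3 \<and> (K + 2) * x1\<^sup>2 + 4 * x2\<^sup>2 = 2 * (K + 2) * x1 * x2 \<or>
        (K + 2) * x1 = 2 * (x2 + x3) \<and> (4 * K + 4) * (x2 * x3) = (K + 2) * ((x2 + x3)\<^sup>2 - x1\<^sup>2)"
      by (simp_all add: iff)
    then consider (eq) "x2 = x3" "(K + 2) * x1\<^sup>2 + 4 * x2\<^sup>2 = 2 * (K + 2) * x1 * x2" |
      (neq) "(K + 2) * x1 = 2 * (x2 + x3)" "(4 * K + 4) * (x2 * x3) = (K + 2) * ((x2 + x3)\<^sup>2 - x1\<^sup>2)"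
      by blast
    then show "\<exists>r\<in>?R. (r, x) \<in> homothety"
    proof cases
      case eq
      have "(K + 2) * (x1 - x2)\<^sup>2 = (K - 2) * x2\<^sup>2"
        using eq(2) by (simp add: algebra_simps power2_eq_square)
      then have "(K + 2) * (x1 - x2)\<^sup>2 = (K + 2) * (d * x2)\<^sup>2"
        unfolding d2[symmetric] by (simp only: power_mult_distrib mult_ac)
      then have "(x1 - x2)\<^sup>2 = (d * x2)\<^sup>2"
        using K by simp
      then have "x1 - x2 = d * x2 \<or> x1 - x2 = - (d * x2)"
        by (simp only: power2_eq_iff)
      then have "x1 = x2 * (1 + d) \<or> x1 = x2 * (1 - d)"
        by (auto simp: algebra_simps)
      then have "((1 + d, 1, 1), x) \<in> homothety \<or> ((1 - d, 1, 1), x) \<in> homothety"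
        using eq(1) homothetyI[OF pos(2), of x1 "1 + d" x2 1 x3 1]
          homothetyI[OF pos(2), of x1 "1 - d" x2 1 x3 1]
        unfolding x by (metis mult_1_right)
      then show ?thesis
        by blast
    next
      case neq
      \<comment> \<open>The factor K + 2 makes it possible to eliminate x1 through the linear
        relation.\<close>
      have "(K + 2) * ((4 * K + 4) * (x2 * x3)) = (K + 2)\<^sup>2 * (x2 + x3)\<^sup>2 - ((K + 2) * x1)\<^sup>2"
        unfolding neq(2) by (simp add: power2_eq_square algebra_simps)
      also have "\<dots> = ((K + 2)\<^sup>2 - 4) * (x2 + x3)\<^sup>2"
        unfolding neq(1) by (simp add: power2_eq_square algebra_simps)
      finally have "(K + 2) * ((4 * K + 4) * (x2 * x3)) = ((K + 2)\<^sup>2 - 4) * (x2 + x3)\<^sup>2" .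
      \<comment> \<open>The inequality 4 x2 x3 \<le> (x2 + x3)^2 excludes this alternative: it would
        force (K - 2) (x2 + x3)^2 \<le> 0.\<close>
      moreover have "(K + 2) * ((K + 1) * (4 * (x2 * x3))) \<le> (K + 2) * ((K + 1) * (x2 + x3)\<^sup>2)"
        using K sum_squares_bound[of x2 x3] by (intro mult_left_mono) (auto simp: power2_sum)
      ultimately have "((K + 2)\<^sup>2 - 4 - (K + 2) * (K + 1)) * (x2 + x3)\<^sup>2 \<le> 0"
        by (simp add: algebra_simps)
      moreover have "(K + 2)\<^sup>2 - 4 - (K + 2) * (K + 1) = K - 2"
        by (simp add: algebra_simps power2_eq_square)
      moreover have "(K - 2) * (x2 + x3)\<^sup>2 > 0"
        using K pos by simp
      ultimately show ?thesis
        by simp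
    qed
  next
    fix r s assume "r \<in> ?R" "s \<in> ?R" "(r, s) \<in> homothety"
    then show "r = s"
      using d by (auto dest!: homothety_cross)
  qed
  then show ?thesis
    using d by simp
qed

text \<open>A quarter of the discriminant of the quadratic for x1 / x2 is K^2 - 4 (L - 1). It
  vanishes exactly for L = 1 + (K / 2)^2, which explains the family with K = 2 s.\<close>

lemma card_einstein_3:
  fixes s :: nat
  assumes "2 \<le> s"
  shows "card (einstein_metrics (2 * s) (1 + s\<^sup>2) (1 + s\<^sup>2) // homothety) = 3"
proof -
  define S where "S = real s"
  \<comment> \<open>Half the difference of x2 and x3 in the second alternative, when x1 = 2 (1 +
    S^2) and the half sum of x2 and x3 is 2 S (S + 1).\<close>
  define D where "D = (S + 1) * (S\<^sup>2 - 1) / sqrt (S * (S + 2))"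
  have S: "S \<ge> 2"
    using assms by (simp add: S_def)
  have S2: "S\<^sup>2 > 1"
    using S by (simp add: power2_eq_square less_1_mult)
  have D2: "D\<^sup>2 * (S * (S + 2)) = ((S + 1) * (S\<^sup>2 - 1))\<^sup>2"
    using S by (simp add: D_def power_divide)
  have D_pos: "0 < D"
    using S S2 by (simp add: D_def)
  \<comment> \<open>This bound keeps the smaller of x2 and x3 positive. It rests on S < sqrt (S (S +
    2)).\<close>
  have D_less: "D < 2 * S * (S + 1)"
  proof -
    have "S < sqrt (S * (S + 2))"
      using S by (intro real_less_rsqrt) (simp add: power2_eq_square algebra_simps)
    then have "S * S < S * sqrt (S * (S + 2))"
      using S by (intro mult_strict_left_mono) auto
    moreover have "0 < S * S"
      using S by simp
    ultimately have "S\<^sup>2 - 1 < 2 * S * sqrt (S * (S + 2))"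
      unfolding power2_eq_square mult.assoc[of 2] by linarith
    then have "(S + 1) * (S\<^sup>2 - 1) < (S + 1) * (2 * S * sqrt (S * (S + 2)))"
      using S by (intro mult_strict_left_mono) auto
    also have "\<dots> = 2 * S * (S + 1) * sqrt (S * (S + 2))"
      by (simp only: mult_ac)
    finally show ?thesis
      using S by (simp only: D_def) (subst pos_divide_less_eq; simp)
  qed
  have iff: "(x1, x2, x3) \<in> einstein_metrics (2 * s) (1 + s\<^sup>2) (1 + s\<^sup>2) \<longleftrightarrow>
    0 < x1 \<and> 0 < x2 \<and> 0 < x3 \<and>
    (x2 = x3 \<and> (S + 1)\<^sup>2 * x1\<^sup>2 + 4 * S\<^sup>2 * x2\<^sup>2 = 4 * S * (S + 1) * x1 * x2 \<or>
     2 * S * (S + 1) * x1 = (1 + S\<^sup>2) * (x2 + x3) \<and>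
       4 * S * (S + 2) * (x2 * x3) = (S + 1)\<^sup>2 * ((x2 + x3)\<^sup>2 - x1\<^sup>2))" for x1 x2 x3
  proof -
    have "2 * S + (1 + S\<^sup>2) = (S + 1)\<^sup>2" "2 * (2 * S + 2 * (1 + S\<^sup>2) - 2) = 4 * S * (S + 1)"
      "2 * S + 2 * (1 + S\<^sup>2) - 2 = 2 * S * (S + 1)" "4 * (2 * S) + 4 * (1 + S\<^sup>2) - 4 = 4 * S * (S + 2)"
      "4 * (1 + S\<^sup>2 - 1) = 4 * S\<^sup>2"
      by (simp_all add: power2_eq_square algebra_simps)
    moreover have "real (2 * s) = 2 * S" "real (1 + s\<^sup>2) = 1 + S\<^sup>2"
      by (simp_all add: S_def)
    moreover have "0 < 2 * s" "0 < 1 + s\<^sup>2"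
      using assms by auto
    ultimately show ?thesis
      using einstein_metrics_equal_blocks_iff[of "2 * s" "1 + s\<^sup>2" x1 x2 x3] by (simp only:)
  qed
  let ?H = "2 * S * (S + 1)" and ?L = "2 * (1 + S\<^sup>2)"
  let ?R = "{(2 * S, S + 1, S + 1), (?L, ?H + D, ?H - D), (?L, ?H - D, ?H + D)}"
  have "card (einstein_metrics (2 * s) (1 + s\<^sup>2) (1 + s\<^sup>2) // homothety) = card ?R"
  proof (rule card_quotient_representatives[OF equiv_homothety])
    have e: "(S + 1)\<^sup>2 * (2 * S)\<^sup>2 + 4 * S\<^sup>2 * (S + 1)\<^sup>2 = 4 * S * (S + 1) * (2 * S) * (S + 1)"
      by (simp add: power2_eq_square algebra_simps)
    have sums: "?H * ?L = (1 + S\<^sup>2) * (?H + D + (?H - D))" "?H * ?L = (1 + S\<^sup>2) * (?H - D + (?H + D))"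
      by (simp_all add: algebra_simps)
    have p: "4 * S * (S + 2) * ((?H + D) * (?H - D)) = (S + 1)\<^sup>2 * ((?H + D + (?H - D))\<^sup>2 - ?L\<^sup>2)"
    proof -
      have "4 * S * (S + 2) * ((?H + D) * (?H - D)) = 4 * S * (S + 2) * ?H\<^sup>2 - 4 * (D\<^sup>2 * (S * (S + 2)))"
        by (simp add: power2_eq_square algebra_simps)
      also have "\<dots> = (S + 1)\<^sup>2 * ((?H + D + (?H - D))\<^sup>2 - ?L\<^sup>2)"
        unfolding D2 by (simp add: power2_eq_square algebra_simps)
      finally show ?thesis .
    qed
    have p': "4 * S * (S + 2) * ((?H - D) * (?H + D)) = (S + 1)\<^sup>2 * ((?H - D + (?H + D))\<^sup>2 - ?L\<^sup>2)"
    proof -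
      have "(?H - D) * (?H + D) = (?H + D) * (?H - D)" "?H - D + (?H + D) = ?H + D + (?H - D)"
        by simp_all
      then show ?thesis
        by (simp only: p)
    qed
    have pos: "0 < 2 * S" "0 < S + 1" "0 < ?L" "0 < ?H + D" "0 < ?H - D"
    proof -
      show "0 < 2 * S" "0 < S + 1" using S by linarith+
      show "0 < ?L" by (simp add: add_pos_nonneg)
      show "0 < ?H - D" using D_less by (rule diff_gt_0_iff_gt[THEN iffD2])
      show "0 < ?H + D" using D_pos less_trans[OF D_pos D_less] by (rule add_pos_pos[rotated])
    qed
    have "(2 * S, S + 1, S + 1) \<in> einstein_metrics (2 * s) (1 + s\<^sup>2) (1 + s\<^sup>2)"
      unfolding iff using e pos by blast
    moreover have "(?L, ?H + D, ?H - D) \<in> einstein_metrics (2 * s) (1 + s\<^sup>2) (1 + s\<^sup>2)"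
      unfolding iff using p sums(1) pos by blast
    moreover have "(?L, ?H - D, ?H + D) \<in> einstein_metrics (2 * s) (1 + s\<^sup>2) (1 + s\<^sup>2)"
      unfolding iff using p' sums(2) pos by blast
    ultimately show "?R \<subseteq> einstein_metrics (2 * s) (1 + s\<^sup>2) (1 + s\<^sup>2)"
      by blast
  next
    fix x assume "x \<in> einstein_metrics (2 * s) (1 + s\<^sup>2) (1 + s\<^sup>2)"
    moreover obtain x1 x2 x3 where x: "x = (x1, x2, x3)"
      by (cases x) auto
    ultimately have "(x1, x2, x3) \<in> einstein_metrics (2 * s) (1 + s\<^sup>2) (1 + s\<^sup>2)"
      by (simp only:)
    then have pos: "0 < x1" "0 < x2" "0 < x3"
      and "x2 = x3 \<and> (S + 1)\<^sup>2 * x1\<^sup>2 + 4 * S\<^sup>2 * x2\<^sup>2 = 4 * S * (S + 1) * x1 * x2 \<or>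
        ?H * x1 = (1 + S\<^sup>2) * (x2 + x3) \<and>
          4 * S * (S + 2) * (x2 * x3) = (S + 1)\<^sup>2 * ((x2 + x3)\<^sup>2 - x1\<^sup>2)"
      unfolding iff by blast+
    then consider
      (eq) "x2 = x3" "(S + 1)\<^sup>2 * x1\<^sup>2 + 4 * S\<^sup>2 * x2\<^sup>2 = 4 * S * (S + 1) * x1 * x2" |
      (neq) "?H * x1 = (1 + S\<^sup>2) * (x2 + x3)"
        "4 * S * (S + 2) * (x2 * x3) = (S + 1)\<^sup>2 * ((x2 + x3)\<^sup>2 - x1\<^sup>2)"
      by blast
    then show "\<exists>r\<in>?R. (r, x) \<in> homothety"
    proof cases
      case eq
      have "((S + 1) * x1 - 2 * S * x2)\<^sup>2 = 0"
        using eq(2) by (simp add: power2_eq_square algebra_simps)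
      then have "x1 = x2 / (S + 1) * (2 * S)"
        using S by (simp add: field_simps)
      then have "((2 * S, S + 1, S + 1), x) \<in> homothety"
        using pos eq(1) S unfolding x by (intro homothetyI[of "x2 / (S + 1)"]) auto
      then show ?thesis
        by blast
    next
      case neq
      \<comment> \<open>The first coordinate fixes the scale. The linear relation then gives the sum
        of x2 and x3, and the quadratic one their difference up to sign.\<close>
      define c where "c = x1 / ?L"
      have L: "?L > 0"
        by (simp add: add_pos_nonneg)
      have c: "c > 0" "x1 = c * ?L"
        using pos L unfolding c_def by auto
      have "(1 + S\<^sup>2) * (x2 + x3) = (1 + S\<^sup>2) * (c * (2 * ?H))"
        using neq(1) unfolding c(2) by (simp only: mult_ac)
      then have sum: "x2 + x3 = c * (2 * ?H)"
        using L by simp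
      have "S * (S + 2) * (x2 - x3)\<^sup>2 = S * (S + 2) * (x2 + x3)\<^sup>2 - 4 * S * (S + 2) * (x2 * x3)"
        by (simp add: power2_eq_square algebra_simps)
      also have "\<dots> = S * (S + 2) * (c * (2 * ?H))\<^sup>2 - (S + 1)\<^sup>2 * ((c * (2 * ?H))\<^sup>2 - (c * ?L)\<^sup>2)"
        unfolding neq(2) sum c(2) ..
      also have "\<dots> = 4 * c\<^sup>2 * (D\<^sup>2 * (S * (S + 2)))"
        unfolding D2 by (simp add: power2_eq_square algebra_simps)
      finally have "S * (S + 2) * (x2 - x3)\<^sup>2 = S * (S + 2) * (c * (2 * D))\<^sup>2"
        by (simp add: power_mult_distrib mult_ac)
      then have "(x2 - x3)\<^sup>2 = (c * (2 * D))\<^sup>2"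
        using S by simp
      then have "x2 - x3 = c * (2 * D) \<or> x2 - x3 = - (c * (2 * D))"
        by (simp add: power2_eq_iff)
      then have "x2 = c * (?H + D) \<and> x3 = c * (?H - D) \<or> x2 = c * (?H - D) \<and> x3 = c * (?H + D)"
        using sum by (auto simp: algebra_simps)
      then have "((?L, ?H + D, ?H - D), x) \<in> homothety \<or> ((?L, ?H - D, ?H + D), x) \<in> homothety"
        using c unfolding x by (auto intro: homothetyI simp del: distrib_left_numeral)
      then show ?thesis
        by blast
    qed
  next
    fix r t assume "r \<in> ?R" "t \<in> ?R" "(r, t) \<in> homothety"
    moreover have "\<not> ((?L, ?H + D, ?H - D), (?L, ?H - D, ?H + D)) \<in> homothety"
      "\<not> ((?L, ?H - D, ?H + D), (?L, ?H + D, ?H - D)) \<in> homothety"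
      using S2 D_pos by (auto dest!: homothety_cross)
    moreover have "((2 * S, S + 1, S + 1), (a, b, c)) \<in> homothety \<Longrightarrow> b = c"
      "((a, b, c), (2 * S, S + 1, S + 1)) \<in> homothety \<Longrightarrow> b = c" for a b c
      using S by (auto dest!: homothety_cross)
    ultimately show "r = t"
      using D_pos by (auto simp del: distrib_left_numeral; force)
  qed
  then show ?thesis
    using D_pos by (simp add: card_insert_if)
qed

text \<open>For three equal blocks both differences f1 - f2 and f2 - f3 split into linear factors.
  Each of the four choices of one factor from each leaves a single ray.\<close>

lemma card_einstein_4:
  fixes t :: nat
  assumes "3 \<le> t"
  shows "card (einstein_metrics t t t // homothety) = 4"
proof -
  define T where "T = real t"
  \<comment> \<open>Chosen so that T + U = 3 T - 2 = n - 2. The triples with two coordinates T and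
    one U then solve the linear relations, and T \<ge> 3 gives U > T, which keeps them apart from
    (1, 1, 1).\<close>
  define U where "U = 2 * T - 2"
  have T: "T \<ge> 3"
    using assms by (simp add: T_def)
  have U: "U > T" "U > 0" "T > 0"
    using T by (simp_all add: U_def)
  have iff: "(x1, x2, x3) \<in> einstein_metrics t t t \<longleftrightarrow>
    0 < x1 \<and> 0 < x2 \<and> 0 < x3 \<and>
    (x1 = x2 \<or> T * (x1 + x2) = (T + U) * x3) \<and> (x2 = x3 \<or> T * (x2 + x3) = (T + U) * x1)" for x1 x2 x3
  proof -
    define N where "N = 2 * (T + U)"
    define f1 f2 f3 where "f1 = N * x2 * x3 + T * (x1\<^sup>2 - x2\<^sup>2 - x3\<^sup>2)"
      and "f2 = N * x1 * x3 + T * (x2\<^sup>2 - x1\<^sup>2 - x3\<^sup>2)"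
      and "f3 = N * x1 * x2 + T * (x3\<^sup>2 - x1\<^sup>2 - x2\<^sup>2)"
    have N: "2 * (real (t + t + t) - 2) = N"
      by (simp add: N_def U_def T_def)
    have "f1 - f2 = 2 * (x1 - x2) * (T * (x1 + x2) - (T + U) * x3)"
      "f2 - f3 = 2 * (x2 - x3) * (T * (x2 + x3) - (T + U) * x1)"
      by (simp_all add: f1_def f2_def f3_def N_def power2_eq_square algebra_simps)
    then have "f1 = f2 \<longleftrightarrow> x1 = x2 \<or> T * (x1 + x2) = (T + U) * x3"
      "f2 = f3 \<longleftrightarrow> x2 = x3 \<or> T * (x2 + x3) = (T + U) * x1"
      by auto
    moreover have "0 < t"
      using assms by simp
    ultimately show ?thesis
      unfolding einstein_metrics_iff[OF \<open>0 < t\<close> \<open>0 < t\<close> \<open>0 < t\<close>] N T_def[symmetric]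
        f1_def[symmetric] f2_def[symmetric] f3_def[symmetric] by simp
  qed
  let ?R = "{(1, 1, 1), (U, T, T), (T, U, T), (T, T, U)}"
  have "card (einstein_metrics t t t // homothety) = card ?R"
  proof (rule card_quotient_representatives[OF equiv_homothety])
    show "?R \<subseteq> einstein_metrics t t t"
      using U by (simp add: iff algebra_simps)
  next
    fix x assume "x \<in> einstein_metrics t t t"
    moreover obtain x1 x2 x3 where x: "x = (x1, x2, x3)"
      by (cases x) auto
    ultimately have pos: "0 < x1" "0 < x2" "0 < x3"
      and "x1 = x2 \<or> T * (x1 + x2) = (T + U) * x3" "x2 = x3 \<or> T * (x2 + x3) = (T + U) * x1"
      by (simp_all add: iff)
    then consider (all) "x1 = x2" "x2 = x3" | (third) "x1 = x2" "T * (x2 + x3) = (T + U) * x1" |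
      (first) "T * (x1 + x2) = (T + U) * x3" "x2 = x3" |
      (second) "T * (x1 + x2) = (T + U) * x3" "T * (x2 + x3) = (T + U) * x1"
      by blast
    then show "\<exists>r\<in>?R. (r, x) \<in> homothety"
    proof cases
      case all
      then have "((1, 1, 1), x) \<in> homothety"
        using pos unfolding x by (intro homothetyI[of x1]) auto
      then show ?thesis
        by blast
    next
      case third
      then have "((T, T, U), x) \<in> homothety"
        using pos U unfolding x by (intro homothetyI[of "x1 / T"]) (auto simp: field_simps)
      then show ?thesis
        by blast
    next
      case first
      then have "((U, T, T), x) \<in> homothety"
        using pos U unfolding x by (intro homothetyI[of "x3 / T"]) (auto simp: field_simps)
      then show ?thesis
        by blast
    next
      case second
      \<comment> \<open>The difference of the two linear relations.\<close>
      have "(2 * T + U) * (x1 - x3) = 0"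
        using second by (simp add: algebra_simps)
      then have "x1 = x3"
        using U by simp
      then have "((T, U, T), x) \<in> homothety"
        using pos U second(1) unfolding x by (intro homothetyI[of "x1 / T"]) (auto simp: field_simps)
      then show ?thesis
        by blast
    qed
  next
    fix r s assume "r \<in> ?R" "s \<in> ?R" "(r, s) \<in> homothety"
    \<comment> \<open>Separates two triples with U in different positions, whose cross products
      compare T^2 with U^2.\<close>
    moreover have "T * T < U * U"
      using U by (intro mult_strict_mono) auto
    ultimately show "r = s"
      using U by (auto dest!: homothety_cross)
  qed
  then show ?thesis
    using U T by simp
qed

lemma infinite_triplesI:
  fixes f :: "nat \<Rightarrow> nat \<times> nat \<times> nat"
  assumes "inj f" "\<And>t. 3 \<le> t \<Longrightarrow> f t \<in> A"
  shows "infinite A"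
proof -
  have "infinite (f ` {3..})"
    using assms(1) by (simp add: finite_image_iff inj_on_subset infinite_Ici)
  then show ?thesis
    using assms(2) by (meson finite_subset image_subsetI atLeast_iff)
qed

theorem theorem3:
  fixes q :: nat
  assumes "q \<in> {2, 3, 4}"
  shows "infinite {(k, l, m). 0 < k \<and> 0 < l \<and> 0 < m \<and>
           card (einstein_metrics k l m // homothety) = q}"
proof -
  consider "q = 2" | "q = 3" | "q = 4"
    using assms by auto
  then show ?thesis
  proof cases
    case 1
    show ?thesis
      by (rule infinite_triplesI[of "\<lambda>t. (t, 2, 2)"]) (auto simp: inj_def 1 card_einstein_2)
  next
    case 2
    show ?thesis
      using card_einstein_3
      by (intro infinite_triplesI[of "\<lambda>t. (2 * t, 1 + t\<^sup>2, 1 + t\<^sup>2)"]) (auto simp: inj_def 2)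
  next
    case 3
    show ?thesis
      by (rule infinite_triplesI[of "\<lambda>t. (t, t, t)"]) (auto simp: inj_def 3 card_einstein_4)
  qed
qed

end
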